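(* The sets $\mathfrak{a}=\{\bar\sigma(\epsilon,0,1,1)\mid\epsilon=\pm1\}$, $\mathfrak{t}=\{\bar\sigma(1,\lambda,1,1)\mid\lambda\in\mathbb{Z}\}$ and $\mathfrak{b}=\{\bar\sigma(1,0,a,d)\mid a,d\in\mathbb{C}^*\}$ are all subgroups of $\mathrm{Aut}(\widetilde{\mathfrak{sv}})$, and $$\mathrm{Aut}(\widetilde{\mathfrak{sv}})=\mathcal{I}\rtimes\big((\mathfrak{a}\ltimes\mathfrak{t})\ltimes\mathfrak{b}\big),$$ where $\mathfrak{a}\cong\mathbb{Z}_2=\{\pm1\}$, $\mathfrak{t}\cong\mathbb{Z}$ and $\mathfrak{b}\cong\mathbb{C}^*\times\mathbb{C}^*$.
   Context: The extended Schrödinger-Virasoro Lie algebra $\widetilde{\mathfrak{sv}}$ is the complex Lie algebra with basis $\{L_n, M_n, N_n, Y_{n+\frac12} \mid n\in\mathbb{Z}\}$ and brackets, for all $m,n\in\mathbb{Z}$: $[L_m,L_n]=(n-m)L_{m+n}$, $[M_m,M_n]=0$, $[N_m,N_n]=0$, $[Y_{m+\frac12},Y_{n+\frac12}]=(m-n)M_{m+n+1}$, $[L_m,M_n]=nM_{m+n}$, $[L_m,N_n]=nN_{m+n}$, $[L_m,Y_{n+\frac12}]=\left(n+\frac{1-m}{2}\right)Y_{m+n+\frac12}$, $[N_m,M_n]=2M_{m+n}$, $[N_m,Y_{n+\frac12}]=Y_{m+n+\frac12}$, $[M_m,Y_{n+\frac12}]=0$. $\mathrm{Aut}(\widetilde{\mathfrak{sv}})$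 is the group of Lie algebra automorphisms, and $\mathcal{I}$ is the inner automorphism group, generated by the elements $\exp(k\,\mathrm{ad}\,M_m+l\,\mathrm{ad}\,Y_{n+\frac12})$ with $m,n\in\mathbb{Z}$, $k,l\in\mathbb{C}$ (these operators $\mathrm{ad}$ are nilpotent). For $\epsilon\in\{\pm1\}$, $\lambda\in\mathbb{Z}$, $a,d\in\mathbb{C}^*=\mathbb{C}\setminus\{0\}$, $\bar\sigma(\epsilon,\lambda,a,d)$ denotes the automorphism of $\widetilde{\mathfrak{sv}}$ given for all $n\in\mathbb{Z}$ by $L_n\mapsto a^n\epsilon L_{\epsilon n}+a^n\lambda N_{\epsilon n}$, $N_n\mapsto a^nN_{\epsilon n}$, $M_n\mapsto\epsilon d^2a^{n-1}M_{\epsilon(n-2\lambda)}$, $Y_{n+\frac12}\mapsto da^nY_{\epsilon(n+\frac12-\lambda)}$. All semidirect products are internal: $H\ltimes K$ (equivalently $K\rtimes H$) has $K$ as its normal factor. *)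

theory Defs
  imports
    "HOL-Algebra.Algebra"
    "HOL-Library.Poly_Mapping"
    Complex_Main
begin

section \<open>The extended Schroedinger-Virasoro Lie algebra\<close>

text \<open>The constructor term \<open>Yb n\<close> stands for $Y_{n+\frac12}$, so that all indices are integers.\<close>

datatype sv_index = Lb int | Mb int | Nb int | Yb int

type_synonym sv = "sv_index \<Rightarrow>\<^sub>0 complex"

definition sv_basis :: "sv_index \<Rightarrow> sv"
  where "sv_basis i = Poly_Mapping.single i 1"

definition sv_scale :: "complex \<Rightarrow> sv \<Rightarrow> sv" (infixr \<open>*\<^sub>s\<close> 75)
  where "c *\<^sub>s x = Poly_Mapping.map ((*) c) x"

lemma lookup_sv_scale [simp]: "Poly_Mapping.lookup (c *\<^sub>s x) i = c * Poly_Mapping.lookup x i"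
  by (simp add: sv_scale_def Poly_Mapping.map.rep_eq when_def)

interpretation sv: vector_space sv_scale
  by unfold_locales (simp_all add: poly_mapping_eq_iff fun_eq_iff lookup_add algebra_simps)

text \<open>The families with the two generators in the opposite order are forced by antisymmetry.\<close>

fun basis_bracket :: "sv_index \<Rightarrow> sv_index \<Rightarrow> sv" where
  "basis_bracket (Lb m) (Lb n) = of_int (n - m) *\<^sub>s sv_basis (Lb (m + n))"
| "basis_bracket (Lb m) (Mb n) = of_int n *\<^sub>s sv_basis (Mb (m + n))"
| "basis_bracket (Lb m) (Nb n) = of_int n *\<^sub>s sv_basis (Nb (m + n))"
| "basis_bracket (Lb m) (Yb n) = (of_int n + (1 - of_int m) / 2) *\<^sub>s sv_basis (Yb (m + n))"
| "basis_bracket (Mb m) (Lb n) = - of_int m *\<^sub>s sv_basis (Mb (m + n))"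
| "basis_bracket (Mb m) (Mb n) = 0"
| "basis_bracket (Mb m) (Nb n) = - 2 *\<^sub>s sv_basis (Mb (m + n))"
| "basis_bracket (Mb m) (Yb n) = 0"
| "basis_bracket (Nb m) (Lb n) = - of_int m *\<^sub>s sv_basis (Nb (m + n))"
| "basis_bracket (Nb m) (Mb n) = 2 *\<^sub>s sv_basis (Mb (m + n))"
| "basis_bracket (Nb m) (Nb n) = 0"
| "basis_bracket (Nb m) (Yb n) = sv_basis (Yb (m + n))"
| "basis_bracket (Yb m) (Lb n) = - (of_int m + (1 - of_int n) / 2) *\<^sub>s sv_basis (Yb (m + n))"
| "basis_bracket (Yb m) (Mb n) = 0"
| "basis_bracket (Yb m) (Nb n) = - sv_basis (Yb (m + n))"
| "basis_bracket (Yb m) (Yb n) = of_int (m - n) *\<^sub>s sv_basis (Mb (m + n + 1))"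

definition sv_bracket :: "sv \<Rightarrow> sv \<Rightarrow> sv"
  where "sv_bracket x y =
    (\<Sum>i\<in>Poly_Mapping.keys x. \<Sum>j\<in>Poly_Mapping.keys y.
      (Poly_Mapping.lookup x i * Poly_Mapping.lookup y j) *\<^sub>s basis_bracket i j)"

definition ad :: "sv \<Rightarrow> sv \<Rightarrow> sv"
  where "ad x = (\<lambda>y. sv_bracket x y)"


section \<open>Automorphisms\<close>

definition lie_automorphisms :: "(sv \<Rightarrow> sv) set"
  where "lie_automorphisms =
    {f. Vector_Spaces.linear sv_scale sv_scale f \<and> bij f \<and>
        (\<forall>x y. f (sv_bracket x y) = sv_bracket (f x) (f y))}"

definition Aut_sv :: "(sv \<Rightarrow> sv) monoid"
  where "Aut_sv = \<lparr>carrier = lie_automorphisms, monoid.mult = (\<circ>), one = id\<rparr>"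

text \<open>The exponential series of an operator. The sum ranges over the finitely many nonzero terms
  when \<open>D\<close> is nilpotent, and the function is only used in that case.\<close>

definition exp_nilpotent :: "(sv \<Rightarrow> sv) \<Rightarrow> sv \<Rightarrow> sv"
  where "exp_nilpotent D = (\<lambda>x. Sum_any (\<lambda>j. (1 / fact j) *\<^sub>s (D ^^ j) x))"

definition Inn_sv :: "(sv \<Rightarrow> sv) set"
  where "Inn_sv = generate Aut_sv
    {exp_nilpotent (\<lambda>x. k *\<^sub>s ad (sv_basis (Mb m)) x + l *\<^sub>s ad (sv_basis (Yb n)) x) | k l m n. True}"

text \<open>Since \<open>Yb n\<close> is $Y_{n+\frac12}$, the target $Y_{\epsilon(n+\frac12-r)}$ is \<open>Yb k\<close> with
  $k = \epsilon(n-r)+\frac{\epsilon-1}{2}$; for $\epsilon=\pm1$ the quotient is an integer.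
  The parameter \<open>r\<close> is the $\lambda$ of $\bar\sigma(\epsilon,\lambda,a,d)$.\<close>

fun sigma_basis :: "int \<Rightarrow> int \<Rightarrow> complex \<Rightarrow> complex \<Rightarrow> sv_index \<Rightarrow> sv" where
  "sigma_basis \<epsilon> r a d (Lb n) =
     (a powi n * of_int \<epsilon>) *\<^sub>s sv_basis (Lb (\<epsilon> * n)) + (a powi n * of_int r) *\<^sub>s sv_basis (Nb (\<epsilon> * n))"
| "sigma_basis \<epsilon> r a d (Nb n) = (a powi n) *\<^sub>s sv_basis (Nb (\<epsilon> * n))"
| "sigma_basis \<epsilon> r a d (Mb n) =
     (of_int \<epsilon> * d ^ 2 * a powi (n - 1)) *\<^sub>s sv_basis (Mb (\<epsilon> * (n - 2 * r)))"
| "sigma_basis \<epsilon> r a d (Yb n) =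
     (d * a powi n) *\<^sub>s sv_basis (Yb (\<epsilon> * (n - r) + (\<epsilon> - 1) div 2))"

definition sigma :: "int \<Rightarrow> int \<Rightarrow> complex \<Rightarrow> complex \<Rightarrow> sv \<Rightarrow> sv"
  where "sigma \<epsilon> r a d x = (\<Sum>i\<in>Poly_Mapping.keys x. Poly_Mapping.lookup x i *\<^sub>s sigma_basis \<epsilon> r a d i)"

definition grp_a :: "(sv \<Rightarrow> sv) set"
  where "grp_a = {sigma \<epsilon> 0 1 1 | \<epsilon>. \<epsilon> \<in> {1, - 1}}"

definition grp_t :: "(sv \<Rightarrow> sv) set"
  where "grp_t = {sigma 1 r 1 1 | r. True}"

definition grp_b :: "(sv \<Rightarrow> sv) set"
  where "grp_b = {sigma 1 0 a d | a d. a \<noteq> 0 \<and> d \<noteq> 0}"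


section \<open>Group-theoretic notions\<close>

text \<open>\<open>G\<close> is the internal semidirect product of its normal subgroup \<open>K\<close> and its subgroup \<open>H\<close>.\<close>

definition internal_semidirect :: "('a, 'b) monoid_scheme \<Rightarrow> 'a set \<Rightarrow> 'a set \<Rightarrow> bool"
  where "internal_semidirect G H K \<longleftrightarrow>
    group G \<and> subgroup H G \<and> K \<lhd> G \<and> H \<inter> K = {\<one>\<^bsub>G\<^esub>} \<and> H <#>\<^bsub>G\<^esub> K = carrier G"

definition sign_group :: "int monoid"
  where "sign_group = \<lparr>carrier = {1, - 1}, monoid.mult = (*), one = 1\<rparr>"

definition complex_units :: "complex monoid"
  where "complex_units = \<lparr>carrier = - {0}, monoid.mult = (*), one = 1\<rparr>"

end

theory Submission
  imports Defs
begin

text \<open>The nilradical, spanned by the \<open>M\<^sub>n\<close> and \<open>Y\<^bsub>n+1/2\<^esub>\<close>, is the set of \<open>x\<close> with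
  \<open>(ad x)\<^sup>3 = 0\<close>, hence invariant under automorphisms. It is nilpotent of class 2, so by the
  Baker-Campbell-Hausdorff formula the inner automorphisms are exactly the maps
  \<open>exp (ad x) = 1 + ad x + (ad x)\<^sup>2 / 2\<close> with \<open>x\<close> in the nilradical, and they form a normal subgroup.

  Let \<open>f\<close> be an automorphism. Modulo the ideal spanned by the \<open>N\<close>, \<open>M\<close> and \<open>Y\<close>, the image of \<open>L\<^sub>0\<close>
  must be \<open>\<plusminus> L\<^sub>0\<close>, because it acts diagonalisably with all Laurent polynomials as eigenvectors;
  so \<open>L\<^sub>n\<close> goes to \<open>\<epsilon> a\<^sup>n L\<^bsub>\<epsilon>n\<^esub>\<close>. After composing with some \<open>sigma \<epsilon> 0 a 1\<close>, let \<open>h\<close> be the \<open>Y\<close>-part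
  of \<open>f Y\<^bsub>1/2\<^esub>\<close> and \<open>u\<close> the \<open>N\<close>-part of \<open>f L\<^sub>0\<close>. The action of the \<open>L\<^sub>n\<close> and \<open>N\<^sub>n\<close> on \<open>Y\<close> yields
  \<open>t h' = - u h\<close>, and the only Laurent polynomial solutions are \<open>h = d t\<^bsup>-r\<^esup>\<close>, \<open>u = r\<close>; these give
  the remaining parameters of a \<open>sigma\<close>. What is left acts trivially on the graded pieces, can be
  corrected by an inner automorphism to fix \<open>N\<^sub>0\<close>, and then is the identity because the
  eigenspaces of \<open>ad N\<^sub>0\<close> separate the graded pieces.\<close>

section \<open>Laurent polynomials\<close>

text \<open>Multiplication of finitely supported maps is convolution of exponents, so this is the
  ring C[t, t^-1] with \<open>Poly_Mapping.single n 1\<close> in the role of t^n.\<close>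

type_synonym laurent = "int \<Rightarrow>\<^sub>0 complex"

abbreviation cst :: "complex \<Rightarrow> laurent"
  where "cst \<equiv> Poly_Mapping.single 0"

definition euler :: "laurent \<Rightarrow> laurent"
  where "euler p = Poly_Mapping.mapp (\<lambda>n c. of_int n * c) p"

lemma lookup_euler [simp]: "Poly_Mapping.lookup (euler p) n = of_int n * Poly_Mapping.lookup p n"
  by (simp add: euler_def lookup_mapp when_def in_keys_iff)

lemma lookup_cst_times [simp]:
  "Poly_Mapping.lookup (cst c * p) n = c * Poly_Mapping.lookup p n"
  by (simp flip: mult_map_scale_conv_mult add: Poly_Mapping.map.rep_eq when_def)

lemma euler_zero [simp]: "euler 0 = 0"
  and euler_add [simp]: "euler (p + q) = euler p + euler q"
  and euler_diff [simp]: "euler (p - q) = euler p - euler q"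
  and euler_uminus [simp]: "euler (- p) = - euler p"
  and euler_single [simp]: "euler (Poly_Mapping.single n c) = Poly_Mapping.single n (of_int n * c)"
  by (auto intro!: poly_mapping_eqI simp: lookup_add lookup_minus lookup_single when_def algebra_simps)

lemma euler_one [simp]: "euler 1 = 0"
  and euler_numeral [simp]: "euler (numeral k) = 0"
  using euler_single[of 0 1] euler_single[of 0 "numeral k"] by simp_all

text \<open>The basis case is restricted to indices in the support of \<open>x\<close>, so facts
  about the support, such as those that follow from membership in the nilradical, stay available
  there without being part of \<open>P\<close>.\<close>

lemma poly_mapping_keys_induct:
  fixes x :: "'a \<Rightarrow>\<^sub>0 'b::comm_monoid_add"
  assumes "P 0" "\<And>x y. P x \<Longrightarrow> P y \<Longrightarrow> P (x + y)"
    and "\<And>i c. i \<in> Poly_Mapping.keys x \<Longrightarrow> P (Poly_Mapping.single i c)"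
  shows "P x"
proof -
  have "P (\<Sum>i\<in>S. Poly_Mapping.single i (Poly_Mapping.lookup x i))"
    if "finite S" "S \<subseteq> Poly_Mapping.keys x" for S
    using that by (induction S rule: finite_induct) (auto intro: assms)
  moreover have "(\<Sum>i\<in>Poly_Mapping.keys x. Poly_Mapping.single i (Poly_Mapping.lookup x i)) = x"
    by (rule poly_mapping_eqI)
      (simp add: lookup_sum lookup_single when_def in_keys_iff)
  ultimately show ?thesis by (metis finite_keys order_refl)
qed

text \<open>Both sides are bilinear, and on monomials the Leibniz rule is additivity of
  exponents.\<close>

lemma euler_times [simp]: "euler (p * q) = euler p * q + p * euler q"
proof (induction p rule: poly_mapping_keys_induct)
  case (3 m c)
  show ?case
    by (induction q rule: poly_mapping_keys_induct)
      (simp_all add: mult_single distrib_left distrib_right algebra_simps flip: single_add)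
qed (simp_all add: algebra_simps)

text \<open>Leading terms at either end are treated together: the sign \<open>s\<close> selects the top or the
  bottom of a Laurent polynomial.\<close>

definition bounded_by :: "int \<Rightarrow> int \<Rightarrow> laurent \<Rightarrow> bool"
  where "bounded_by s k p \<longleftrightarrow> (\<forall>n\<in>Poly_Mapping.keys p. s * n \<le> s * k)"

lemma bounded_by_lookup:
  "bounded_by s k p \<longleftrightarrow> (\<forall>n. s * k < s * n \<longrightarrow> Poly_Mapping.lookup p n = 0)"
  by (meson bounded_by_def in_keys_iff not_less)

lemma bounded_by_zero [simp]: "bounded_by s k 0"
  and bounded_by_add: "bounded_by s k p \<Longrightarrow> bounded_by s k q \<Longrightarrow> bounded_by s k (p + q)"
  and bounded_by_diff: "bounded_by s k p \<Longrightarrow> bounded_by s k q \<Longrightarrow> bounded_by s k (p - q)"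
  and bounded_by_euler: "bounded_by s k p \<Longrightarrow> bounded_by s k (euler p)"
  and bounded_by_cst: "bounded_by s k p \<Longrightarrow> bounded_by s k (cst c * p)"
  by (auto simp: bounded_by_lookup lookup_add lookup_minus)

lemma bounded_by_times:
  assumes "bounded_by s k p" "bounded_by s m q"
  shows "bounded_by s (k + m) (p * q)"
  unfolding bounded_by_def
proof
  fix n assume "n \<in> Poly_Mapping.keys (p * q)"
  then obtain a b where "n = a + b" "a \<in> Poly_Mapping.keys p" "b \<in> Poly_Mapping.keys q"
    using keys_mult[of p q] by blast
  then have "s * a \<le> s * k" "s * b \<le> s * m" "s * n = s * a + s * b"
    using assms by (auto simp: bounded_by_def distrib_left)
  then show "s * n \<le> s * (k + m)" by (simp add: distrib_left)
qed

lemma lookup_times_single: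
  fixes p :: laurent
  shows "Poly_Mapping.lookup (p * Poly_Mapping.single m c) n = Poly_Mapping.lookup p (n - m) * c"
  by (induction p rule: poly_mapping_keys_induct)
    (auto simp: lookup_add mult_single lookup_single when_def algebra_simps)

text \<open>Removing the leading monomial from \<open>p\<close> leaves a remainder whose product
  with \<open>q\<close> no longer reaches exponent \<open>k + m\<close>.\<close>

lemma lookup_times_leading:
  assumes p: "bounded_by s k p" and q: "bounded_by s m q" and s: "s * s = 1"
  shows "Poly_Mapping.lookup (p * q) (k + m) = Poly_Mapping.lookup p k * Poly_Mapping.lookup q m"
proof -
  define t where "t = Poly_Mapping.single k (Poly_Mapping.lookup p k)"
  \<comment> \<open>Since \<open>s\<close> is 1 or -1, \<open>k - s\<close> is the next exponent
    inwards at either end.\<close>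
  have "bounded_by s (k - s) (p - t)"
    unfolding bounded_by_lookup
  proof (intro allI impI)
    fix n assume "s * (k - s) < s * n"
    then have "s * k \<le> s * n" using s by (simp add: right_diff_distrib)
    moreover have "n = k" if "s * k = s * n" using s that by auto
    ultimately have "n = k \<or> s * k < s * n" by (metis order_le_imp_less_or_eq)
    then show "Poly_Mapping.lookup (p - t) n = 0"
    proof
      assume "s * k < s * n"
      then have "n \<noteq> k" "Poly_Mapping.lookup p n = 0" using p by (auto simp: bounded_by_lookup)
      then show ?thesis by (simp add: t_def lookup_minus lookup_single when_def)
    qed (simp add: t_def lookup_minus)
  qed
  from bounded_by_times[OF this q] have "Poly_Mapping.lookup ((p - t) * q) (k + m) = 0"
    using s by (simp add: bounded_by_lookup algebra_simps)
  moreover have "Poly_Mapping.lookup (t * q) (k + m) = Poly_Mapping.lookup p k * Poly_Mapping.lookup q m"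
    by (simp add: t_def lookup_times_single mult.commute[of _ q])
  ultimately show ?thesis
    by (simp add: left_diff_distrib lookup_minus)
qed

lemma leading_exponent:
  assumes "p \<noteq> 0" "s * s = 1"
  obtains k where "bounded_by s k p" "Poly_Mapping.lookup p k \<noteq> 0"
proof -
  have "s = 1 \<or> s = - 1" using assms(2) by (metis zmult_eq_1_iff)
  let ?K = "Poly_Mapping.keys p"
  have K: "finite ?K" "?K \<noteq> {}" using assms(1) by (auto simp: poly_mapping_eq_iff fun_eq_iff in_keys_iff)
  let ?k = "if s = 1 then Max ?K else Min ?K"
  have "?k \<in> ?K" using Max_in[OF K] Min_in[OF K] by simp
  moreover have "bounded_by s ?k p"
    using \<open>s = 1 \<or> s = - 1\<close> K by (auto simp: bounded_by_def)
  ultimately show ?thesis using that by (auto simp: in_keys_iff)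
qed

section \<open>Leading terms and eigenvectors of brackets of vector fields\<close>

lemma lookup_witt_leading:
  assumes "bounded_by s k f" "bounded_by s m g" "s * s = 1"
  shows "Poly_Mapping.lookup (f * euler g - g * euler f) (k + m) =
    of_int (m - k) * (Poly_Mapping.lookup f k * Poly_Mapping.lookup g m)"
  using lookup_times_leading[OF assms(1) bounded_by_euler[OF assms(2)] assms(3)]
    lookup_times_leading[OF assms(2) bounded_by_euler[OF assms(1)] assms(3)]
  by (simp add: lookup_minus algebra_simps)

lemma bounded_by_witt:
  assumes "bounded_by s k f" "bounded_by s m g"
  shows "bounded_by s (k + m) (f * euler g - g * euler f)"
  using bounded_by_times[OF assms(1) bounded_by_euler[OF assms(2)]]
    bounded_by_times[OF assms(2) bounded_by_euler[OF assms(1)]]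
  by (intro bounded_by_diff) (simp_all add: add.commute)

text \<open>Suppose \<open>p\<close> leads at \<open>m\<close> beyond \<open>k\<close>. The bracket
  has a nonzero coefficient at \<open>k + m\<close>, so \<open>k + m\<close> is an exponent of
  \<open>p\<close> and \<open>k\<close> points inwards. Then \<open>\<mu> * p\<close> is bounded by
  \<open>k + m\<close>, which forces \<open>\<mu> = 0\<close> and makes that coefficient
  vanish.\<close>

lemma witt_eigenvector_bounded:
  assumes f: "bounded_by s k f" "Poly_Mapping.lookup f k \<noteq> 0" and "k \<noteq> 0" and s: "s * s = 1"
    and eig: "f * euler p - p * euler f = cst \<mu> * p"
  shows "bounded_by s k p"
proof (cases "p = 0")
  case False
  then obtain m where m: "bounded_by s m p" "Poly_Mapping.lookup p m \<noteq> 0"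
    using leading_exponent s by metis
  have "Poly_Mapping.lookup (f * euler p - p * euler f) (k + m) =
      of_int (m - k) * (Poly_Mapping.lookup f k * Poly_Mapping.lookup p m)"
    using lookup_witt_leading[OF f(1) m(1) s] .
  then have lead: "\<mu> * Poly_Mapping.lookup p (k + m) = of_int (m - k) * (Poly_Mapping.lookup f k * Poly_Mapping.lookup p m)"
    by (simp add: eig)
  have "s * m \<le> s * k"
  proof (rule ccontr)
    assume *: "\<not> s * m \<le> s * k"
    then have "m \<noteq> k" by auto
    with lead f(2) m(2) have "Poly_Mapping.lookup p (k + m) \<noteq> 0" by auto
    with m(1) have "s * (k + m) \<le> s * m"
      by (meson bounded_by_lookup not_le)
    then have "s * k \<le> 0" by (simp add: distrib_left)
    moreover have "s * k \<noteq> 0" using s \<open>k \<noteq> 0\<close> by auto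
    ultimately have "s * k < 0" by linarith
    have "bounded_by s (k + m) (cst \<mu> * p)"
      using bounded_by_witt[OF f(1) m(1)] by (simp add: eig)
    moreover have "s * (k + m) < s * m"
      using \<open>s * k < 0\<close> by (simp add: distrib_left)
    ultimately have "\<mu> * Poly_Mapping.lookup p m = 0"
      by (auto simp: bounded_by_lookup)
    then show False
      using m(2) lead f(2) \<open>m \<noteq> k\<close> by simp
  qed
  then show ?thesis using m(1) by (auto simp: bounded_by_def intro: order_trans)
qed simp

section \<open>The Lie algebra in terms of Laurent polynomials\<close>

definition Lc :: "sv \<Rightarrow> laurent" where "Lc = Poly_Mapping.map_key Lb"
definition Mc :: "sv \<Rightarrow> laurent" where "Mc = Poly_Mapping.map_key Mb"
definition Nc :: "sv \<Rightarrow> laurent" where "Nc = Poly_Mapping.map_key Nb"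
definition Yc :: "sv \<Rightarrow> laurent" where "Yc = Poly_Mapping.map_key Yb"

lemma lookup_comps [simp]:
  "Poly_Mapping.lookup (Lc x) n = Poly_Mapping.lookup x (Lb n)"
  "Poly_Mapping.lookup (Mc x) n = Poly_Mapping.lookup x (Mb n)"
  "Poly_Mapping.lookup (Nc x) n = Poly_Mapping.lookup x (Nb n)"
  "Poly_Mapping.lookup (Yc x) n = Poly_Mapping.lookup x (Yb n)"
  by (simp_all add: Lc_def Mc_def Nc_def Yc_def map_key.rep_eq inj_def)

lemma sv_eqI:
  assumes "Lc x = Lc y" "Nc x = Nc y" "Yc x = Yc y" "Mc x = Mc y"
  shows "x = y"
proof (rule poly_mapping_eqI)
  show "Poly_Mapping.lookup x i = Poly_Mapping.lookup y i" for i
    using assms by (cases i) (metis lookup_comps)+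
qed

lemma comps_zero [simp]: "Lc 0 = 0" "Mc 0 = 0" "Nc 0 = 0" "Yc 0 = 0"
  and comps_add [simp]: "Lc (x + y) = Lc x + Lc y" "Mc (x + y) = Mc x + Mc y"
    "Nc (x + y) = Nc x + Nc y" "Yc (x + y) = Yc x + Yc y"
  and comps_diff [simp]: "Lc (x - y) = Lc x - Lc y" "Mc (x - y) = Mc x - Mc y"
    "Nc (x - y) = Nc x - Nc y" "Yc (x - y) = Yc x - Yc y"
  and comps_uminus [simp]: "Lc (- x) = - Lc x" "Mc (- x) = - Mc x"
    "Nc (- x) = - Nc x" "Yc (- x) = - Yc x"
  and comps_scale [simp]: "Lc (c *\<^sub>s x) = cst c * Lc x" "Mc (c *\<^sub>s x) = cst c * Mc x"
    "Nc (c *\<^sub>s x) = cst c * Nc x" "Yc (c *\<^sub>s x) = cst c * Yc x"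
  by (auto intro!: poly_mapping_eqI simp: lookup_add lookup_minus)

lemma comps_basis [simp]:
  "Lc (sv_basis (Lb n)) = Poly_Mapping.single n 1" "Mc (sv_basis (Lb n)) = 0"
  "Nc (sv_basis (Lb n)) = 0" "Yc (sv_basis (Lb n)) = 0"
  "Lc (sv_basis (Mb n)) = 0" "Mc (sv_basis (Mb n)) = Poly_Mapping.single n 1"
  "Nc (sv_basis (Mb n)) = 0" "Yc (sv_basis (Mb n)) = 0"
  "Lc (sv_basis (Nb n)) = 0" "Mc (sv_basis (Nb n)) = 0"
  "Nc (sv_basis (Nb n)) = Poly_Mapping.single n 1" "Yc (sv_basis (Nb n)) = 0"
  "Lc (sv_basis (Yb n)) = 0" "Mc (sv_basis (Yb n)) = 0"
  "Nc (sv_basis (Yb n)) = 0" "Yc (sv_basis (Yb n)) = Poly_Mapping.single n 1"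
  by (auto intro!: poly_mapping_eqI simp: sv_basis_def lookup_single when_def)

lemma single_eq_scale_basis: "Poly_Mapping.single i c = c *\<^sub>s sv_basis i"
  by (auto intro!: poly_mapping_eqI simp: sv_basis_def lookup_single when_def)

lemma sv_keys_induct [case_names zero add basis]:
  assumes "P 0" "\<And>x y. P x \<Longrightarrow> P y \<Longrightarrow> P (x + y)"
    and "\<And>i c. i \<in> Poly_Mapping.keys x \<Longrightarrow> P (c *\<^sub>s sv_basis i)"
  shows "P x"
  by (rule poly_mapping_keys_induct) (simp_all add: single_eq_scale_basis assms)

lemma sv_induct [case_names zero add basis]:
  assumes "P 0" "\<And>x y. P x \<Longrightarrow> P y \<Longrightarrow> P (x + y)"
    and "\<And>i c. P (c *\<^sub>s sv_basis i)"
  shows "P x"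
  using assms by (rule sv_keys_induct)

text \<open>The defining sums run over supports, which change under addition; over a common larger
  index set bilinearity is termwise.\<close>

lemma sv_bracket_superset:
  assumes "finite S" "finite T" "Poly_Mapping.keys x \<subseteq> S" "Poly_Mapping.keys y \<subseteq> T"
  shows "sv_bracket x y =
    (\<Sum>i\<in>S. \<Sum>j\<in>T. (Poly_Mapping.lookup x i * Poly_Mapping.lookup y j) *\<^sub>s basis_bracket i j)"
proof -
  have "(\<Sum>j\<in>Poly_Mapping.keys y. (Poly_Mapping.lookup x i * Poly_Mapping.lookup y j) *\<^sub>s basis_bracket i j) =
      (\<Sum>j\<in>T. (Poly_Mapping.lookup x i * Poly_Mapping.lookup y j) *\<^sub>s basis_bracket i j)" for i
    using assms by (intro sum.mono_neutral_left) (auto simp: in_keys_iff)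
  then show ?thesis
    unfolding sv_bracket_def using assms
    by (simp, intro sum.mono_neutral_left) (auto simp: in_keys_iff)
qed

lemma sv_bracket_add_left: "sv_bracket (x + y) z = sv_bracket x z + sv_bracket y z"
proof -
  let ?S = "Poly_Mapping.keys x \<union> Poly_Mapping.keys y"
  have S: "finite ?S" "Poly_Mapping.keys (x + y) \<subseteq> ?S" by (simp_all add: Poly_Mapping.keys_add)
  show ?thesis
    by (simp add: sv_bracket_superset[OF S(1) finite_keys _ order_refl] S(2) lookup_add
        distrib_right sv.scale_left_distrib sum.distrib)
qed

lemma sv_bracket_add_right: "sv_bracket x (y + z) = sv_bracket x y + sv_bracket x z"
proof -
  let ?S = "Poly_Mapping.keys y \<union> Poly_Mapping.keys z"
  have S: "finite ?S" "Poly_Mapping.keys (y + z) \<subseteq> ?S" by (simp_all add: Poly_Mapping.keys_add)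
  show ?thesis
    by (simp add: sv_bracket_superset[OF finite_keys S(1) order_refl] S(2) lookup_add
        distrib_left sv.scale_left_distrib sum.distrib)
qed

lemma keys_scale: "Poly_Mapping.keys (c *\<^sub>s x) \<subseteq> Poly_Mapping.keys x"
  by (auto simp: in_keys_iff)

lemma sv_bracket_scale_left: "sv_bracket (c *\<^sub>s x) y = c *\<^sub>s sv_bracket x y"
  by (subst sv_bracket_superset[OF finite_keys finite_keys keys_scale order_refl])
    (simp add: sv_bracket_def sv.scale_sum_right mult.assoc)

lemma sv_bracket_scale_right: "sv_bracket x (c *\<^sub>s y) = c *\<^sub>s sv_bracket x y"
  by (subst sv_bracket_superset[OF finite_keys finite_keys order_refl keys_scale])
    (simp add: sv_bracket_def sv.scale_sum_right mult.assoc mult.left_commute)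

lemma sv_bracket_zero [simp]: "sv_bracket 0 y = 0" "sv_bracket x 0 = 0"
  by (simp_all add: sv_bracket_def)

lemma sv_bracket_uminus [simp]: "sv_bracket (- x) y = - sv_bracket x y" "sv_bracket x (- y) = - sv_bracket x y"
  using sv_bracket_scale_left[of "- 1" x y] sv_bracket_scale_right[of x "- 1" y] by simp_all

lemma sv_bracket_diff_left: "sv_bracket (x - y) z = sv_bracket x z - sv_bracket y z"
  and sv_bracket_diff_right: "sv_bracket x (y - z) = sv_bracket x y - sv_bracket x z"
  using sv_bracket_add_left[of x "- y" z] sv_bracket_add_right[of x y "- z"] by simp_all

lemmas sv_bracket_bilinear = sv_bracket_add_left sv_bracket_add_right sv_bracket_scale_left
  sv_bracket_scale_right sv_bracket_diff_left sv_bracket_diff_right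

lemma sv_bracket_basis [simp]: "sv_bracket (sv_basis i) (sv_basis j) = basis_bracket i j"
  by (simp add: sv_bracket_def sv_basis_def)

lemma numeral_times_single:
  "numeral k * Poly_Mapping.single n c = (Poly_Mapping.single n (numeral k * c) :: laurent)"
  using mult_single[of 0 "numeral k" n c] by simp

abbreviation half :: laurent
  where "half \<equiv> cst (1 / 2)"

lemma two_half [simp]: "2 * half = 1"
  by (simp flip: single_numeral add: mult_single)

text \<open>An element of the algebra is a quadruple \<open>(f, e, h, g)\<close> of Laurent polynomials in \<open>t\<close>, and \<open>euler\<close> is
  \<open>t d/dt\<close>. The \<open>L\<close>-part consists of the vector fields on the circle, the \<open>N\<close>-, \<open>M\<close>- and
  \<open>Y\<close>-parts are modules of tensor densities.\<close>

lemma comps_sv_bracket: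
  "Lc (sv_bracket x y) = Lc x * euler (Lc y) - Lc y * euler (Lc x)" (is "?L x y")
  "Nc (sv_bracket x y) = Lc x * euler (Nc y) - Lc y * euler (Nc x)" (is "?N x y")
  "Yc (sv_bracket x y) =
     Lc x * (euler (Yc y) + half * Yc y) - half * euler (Lc x) * Yc y
     - Lc y * (euler (Yc x) + half * Yc x) + half * euler (Lc y) * Yc x
     + Nc x * Yc y - Nc y * Yc x" (is "?Y x y")
  "Mc (sv_bracket x y) =
     Lc x * euler (Mc y) - Lc y * euler (Mc x) + 2 * (Nc x * Mc y - Nc y * Mc x)
     + Poly_Mapping.single 1 1 * (euler (Yc x) * Yc y - Yc x * euler (Yc y))" (is "?M x y")
proof -
  have "?L x y \<and> ?N x y \<and> ?Y x y \<and> ?M x y"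
  proof (induction x rule: sv_induct)
    case (basis i c)
    show ?case
    proof (induction y rule: sv_induct)
      case (basis j d)
      \<comment> \<open>The terms with \<open>half\<close> stem from the coefficient
        \<open>n + (1 - m) / 2\<close>: the summand 1/2 multiplies the \<open>Y\<close> part, and
        -m/2 differentiates the vector field.\<close>
      show ?case
        by (cases i; cases j;
          simp add: sv_bracket_scale_left sv_bracket_scale_right mult_single numeral_times_single
            field_simps flip: single_add single_diff single_uminus;
          (rule arg_cong[of _ _ "Poly_Mapping.single _"], simp add: field_simps)?)
    next
      case (add y z)
      show ?case
        by (simp only: sv_bracket_add_right comps_add add euler_add) (simp add: algebra_simps)
    qed simp
  next
    case (add x z)
    show ?case
      by (simp only: sv_bracket_add_left comps_add add euler_add) (simp add: algebra_simps)
  qed simp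
  then show "?L x y" "?N x y" "?Y x y" "?M x y" by blast+
qed

lemma sv_bracket_self [simp]: "sv_bracket x x = 0"
  by (rule sv_eqI) (simp_all add: comps_sv_bracket algebra_simps)

text \<open>Componentwise this follows from the Leibniz rule and commutativity.\<close>

lemma sv_bracket_jacobi:
  "sv_bracket x (sv_bracket y z) = sv_bracket (sv_bracket x y) z + sv_bracket y (sv_bracket x z)"
proof (rule sv_eqI)
  \<comment> \<open>Writing t as \<open>2 * T\<close> absorbs the products of t with
    \<open>half\<close> into one atom that \<open>euler\<close> fixes.\<close>
  obtain T where T: "Poly_Mapping.single 1 1 * half = T" by blast
  have "euler T = T" by (simp flip: T)
  moreover have "Poly_Mapping.single 1 1 = 2 * T"
    using T by (metis mult.left_commute mult.right_neutral two_half)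
  ultimately show "Mc (sv_bracket x (sv_bracket y z)) = Mc (sv_bracket (sv_bracket x y) z + sv_bracket y (sv_bracket x z))"
    by (simp add: comps_sv_bracket) (simp add: algebra_simps T)
qed (simp_all add: comps_sv_bracket algebra_simps)

section \<open>The nilradical and the inner automorphisms\<close>

definition nilradical :: "sv set"
  where "nilradical = {x. Lc x = 0 \<and> Nc x = 0}"

lemma nilradical_zero [simp]: "0 \<in> nilradical"
  and nilradical_add: "x \<in> nilradical \<Longrightarrow> y \<in> nilradical \<Longrightarrow> x + y \<in> nilradical"
  and nilradical_uminus: "x \<in> nilradical \<Longrightarrow> - x \<in> nilradical"
  and nilradical_scale: "x \<in> nilradical \<Longrightarrow> c *\<^sub>s x \<in> nilradical"
  and nilradical_bracket: "x \<in> nilradical \<Longrightarrow> sv_bracket x z \<in> nilradical"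
  and nilradical_basis: "sv_basis (Mb n) \<in> nilradical" "sv_basis (Yb n) \<in> nilradical"
  by (auto simp: nilradical_def comps_sv_bracket)

text \<open>Two elements of the nilradical bracket into the \<open>M\<close> part, which is central
  in the nilradical.\<close>

lemma nilradical_nilpotent [simp]:
  assumes "x \<in> nilradical" "y \<in> nilradical" "z \<in> nilradical"
  shows "sv_bracket x (sv_bracket y z) = 0" "sv_bracket (sv_bracket x y) z = 0"
  using assms by (auto intro!: sv_eqI simp: nilradical_def comps_sv_bracket)

text \<open>The extra fact in the second case rules out \<open>Y\<close> indices when
  \<open>x\<close> has no \<open>Y\<close> part.\<close>

lemma keys_nilradical:
  assumes "x \<in> nilradical" "i \<in> Poly_Mapping.keys x"
  obtains n where "i = Mb n" | n where "i = Yb n" "Yc x \<noteq> 0"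
proof -
  have "Poly_Mapping.lookup x (Lb n) = 0" "Poly_Mapping.lookup x (Nb n) = 0" for n
    using assms(1) by (simp_all flip: lookup_comps add: nilradical_def)
  moreover have "Yc x \<noteq> 0" if "i = Yb n" for n
    using that assms(2) by (auto simp: in_keys_iff simp flip: lookup_comps(4))
  ultimately show ?thesis using assms(2) that by (cases i) (auto simp: in_keys_iff)
qed

text \<open>If the \<open>L\<close>-part of \<open>x\<close> has leading exponent \<open>k\<close>, then three applications of \<open>ad x\<close> multiply
  the leading coefficient of a vector field of degree \<open>m\<close> by \<open>(m - k) m (m + k)\<close> times a nonzero
  number.\<close>

lemma nilradical_iff_ad_nilpotent:
  "x \<in> nilradical \<longleftrightarrow> (\<forall>y. sv_bracket x (sv_bracket x (sv_bracket x y)) = 0)"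
proof
  assume "x \<in> nilradical"
  then show "\<forall>y. sv_bracket x (sv_bracket x (sv_bracket x y)) = 0"
    by (simp add: nilradical_bracket)
next
  assume nil: "\<forall>y. sv_bracket x (sv_bracket x (sv_bracket x y)) = 0"
  define f where "f = Lc x"
  have "f = 0"
  proof (rule ccontr)
    assume "f \<noteq> 0"
    then obtain k where k: "bounded_by 1 k f" "Poly_Mapping.lookup f k \<noteq> 0"
      using leading_exponent[of f 1] by auto
    \<comment> \<open>This choice keeps \<open>m - k\<close>, \<open>m\<close> and
      \<open>m + k\<close> all nonzero.\<close>
    define m where "m = \<bar>k\<bar> + 1"
    define W where "W g = f * euler g - g * euler f" for g
    have W: "bounded_by 1 (k + j) (W g)"
      "Poly_Mapping.lookup (W g) (k + j) = of_int (j - k) * (Poly_Mapping.lookup f k * Poly_Mapping.lookup g j)"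
      if "bounded_by 1 j g" for g j
      using bounded_by_witt[OF k(1) that] lookup_witt_leading[OF k(1) that] by (simp_all add: W_def)
    define g where "g = Lc (sv_basis (Lb m))"
    have "bounded_by 1 m g" by (simp add: g_def bounded_by_def)
    note W1 = W[OF this] and W2 = W[OF W(1)[OF this]] and W3 = W[OF W(1)[OF W(1)[OF this]]]
    have "W (W (W g)) = 0"
      using nil[rule_format, of "sv_basis (Lb m)", THEN arg_cong, of Lc]
      unfolding comps_sv_bracket(1) f_def[symmetric] W_def g_def by simp
    moreover have "Poly_Mapping.lookup g m = 1" by (simp add: g_def)
    ultimately have "k + (k + m) - k = 0 \<or> k + m - k = 0 \<or> m - k = 0"
      using W1(2) W2(2) W3(2) k(2)
      by (metis lookup_zero mult_eq_0_iff of_int_eq_0_iff one_neq_zero)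
    then show False
      unfolding m_def by auto
  qed
  moreover have "Nc x = 0"
  proof -
    \<comment> \<open>Once the \<open>L\<close> part vanishes, each application of
      \<open>ad x\<close>, starting from \<open>Yb 0\<close>, multiplies the \<open>Y\<close> part
      by \<open>Nc x\<close>.\<close>
    have "Nc x * (Nc x * (Nc x * 1)) = 0"
      using nil[rule_format, of "sv_basis (Yb 0)", THEN arg_cong, of Yc] \<open>f = 0\<close>
      by (simp add: comps_sv_bracket f_def)
    then show ?thesis by simp
  qed
  ultimately show "x \<in> nilradical" by (simp add: nilradical_def f_def)
qed

section \<open>Exponentials of the nilradical and their composition\<close>

definition nexp :: "sv \<Rightarrow> sv \<Rightarrow> sv"
  where "nexp x z = z + sv_bracket x z + (1 / 2) *\<^sub>s sv_bracket x (sv_bracket x z)"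

lemma nexp_zero [simp]: "nexp 0 = id"
  by (simp add: nexp_def fun_eq_iff)

lemma nexp_add: "nexp x (y + z) = nexp x y + nexp x z"
  by (simp add: nexp_def sv_bracket_bilinear sv.scale_right_distrib)

lemma nexp_scale: "nexp x (c *\<^sub>s y) = c *\<^sub>s nexp x y"
  by (simp add: nexp_def sv_bracket_bilinear sv.scale_right_distrib mult.commute)

text \<open>\<open>ad x\<close> is a derivation, so its exponential is multiplicative; the vanishing
  brackets are the mixed terms of order above two.\<close>

lemma nexp_bracket:
  assumes "x \<in> nilradical"
  shows "nexp x (sv_bracket y z) = sv_bracket (nexp x y) (nexp x z)"
proof -
  have "sv_bracket (sv_bracket x y) (sv_bracket x (sv_bracket x z)) = 0"
    "sv_bracket (sv_bracket x (sv_bracket x y)) (sv_bracket x z) = 0"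
    "sv_bracket (sv_bracket x (sv_bracket x y)) (sv_bracket x (sv_bracket x z)) = 0"
    using assms by (simp_all add: nilradical_bracket)
  then show ?thesis
    by (simp add: nexp_def sv_bracket_bilinear sv_bracket_jacobi[of x y z]
        sv_bracket_jacobi[of x "sv_bracket x y" z] sv_bracket_jacobi[of x y "sv_bracket x z"])
      (simp add: poly_mapping_eq_iff fun_eq_iff lookup_add field_simps)
qed

text \<open>Baker-Campbell-Hausdorff in class 2. Three factors \<open>ad\<close> of nilradical
  elements compose to zero, with the \<open>ad\<close> of a commutator counting as two, so only
  terms up to order two are left to compare.\<close>

lemma nexp_compose:
  assumes x: "x \<in> nilradical" and y: "y \<in> nilradical"
  shows "nexp x \<circ> nexp y = nexp (x + y + (1 / 2) *\<^sub>s sv_bracket x y)"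
proof
  fix z
  have "sv_bracket x (sv_bracket y (sv_bracket y z)) = 0"
    "sv_bracket x (sv_bracket x (sv_bracket y z)) = 0"
    "sv_bracket x (sv_bracket (sv_bracket x y) z) = 0"
    "sv_bracket y (sv_bracket (sv_bracket x y) z) = 0"
    "sv_bracket (sv_bracket x y) (sv_bracket x z) = 0"
    "sv_bracket (sv_bracket x y) (sv_bracket y z) = 0"
    "sv_bracket (sv_bracket x y) (sv_bracket (sv_bracket x y) z) = 0"
    using x y
    by (simp_all add: nilradical_bracket sv_bracket_jacobi[of x "sv_bracket x y"]
        sv_bracket_jacobi[of y "sv_bracket x y"])
  moreover have "sv_bracket (sv_bracket x y) z = sv_bracket x (sv_bracket y z) - sv_bracket y (sv_bracket x z)"
    by (simp add: sv_bracket_jacobi[of x y z])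
  ultimately show "(nexp x \<circ> nexp y) z = nexp (x + y + (1 / 2) *\<^sub>s sv_bracket x y) z"
    by (simp add: nexp_def sv_bracket_bilinear)
      (simp add: poly_mapping_eq_iff fun_eq_iff lookup_add lookup_minus field_simps)
qed

lemma nexp_neg_compose:
  assumes "x \<in> nilradical"
  shows "nexp x \<circ> nexp (- x) = id" "nexp (- x) \<circ> nexp x = id"
  using nexp_compose[OF assms nilradical_uminus[OF assms]] nexp_compose[OF nilradical_uminus[OF assms] assms]
  by simp_all

lemma exp_nilpotent_ad:
  assumes "x \<in> nilradical"
  shows "exp_nilpotent (ad x) = nexp x"
proof
  fix z
  have "(ad x ^^ 3) z = 0"
    using assms by (simp add: eval_nat_numeral ad_def nilradical_bracket)
  then have *: "(ad x ^^ (k + 3)) z = 0" for k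
    unfolding funpow_add by (induction k) (simp_all add: ad_def)
  have "(ad x ^^ j) z = 0" if "j \<notin> {0, 1, 2}" for j
  proof -
    have "j \<ge> 3" using that by (cases "j < 3") (auto simp: less_Suc_eq eval_nat_numeral)
    with *[of "j - 3"] show ?thesis by simp
  qed
  then have "{j. (1 / fact j) *\<^sub>s (ad x ^^ j) z \<noteq> 0} \<subseteq> {0, 1, 2}" by auto
  then have "exp_nilpotent (ad x) z = (\<Sum>j\<in>{0, 1, 2}. (1 / fact j) *\<^sub>s (ad x ^^ j) z)"
    unfolding exp_nilpotent_def by (intro Sum_any.expand_superset) auto
  also have "\<dots> = nexp x z"
    by (simp add: nexp_def ad_def eval_nat_numeral add.assoc)
  finally show "exp_nilpotent (ad x) z = nexp x z" .
qed

section \<open>The group of Lie algebra automorphisms\<close>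

lemma linear_svI:
  assumes "\<And>x y. f (x + y) = f x + f y" "\<And>c x. f (c *\<^sub>s x) = c *\<^sub>s f x"
  shows "Vector_Spaces.linear sv_scale sv_scale f"
  using assms by unfold_locales auto

lemma lie_automorphismI:
  assumes "\<And>x y. f (x + y) = f x + f y" "\<And>c x. f (c *\<^sub>s x) = c *\<^sub>s f x"
    "\<And>x y. f (sv_bracket x y) = sv_bracket (f x) (f y)" "f \<circ> g = id" "g \<circ> f = id"
  shows "f \<in> lie_automorphisms"
  using assms o_bij[of g f] by (simp add: lie_automorphisms_def linear_svI)

lemma lie_automorphismD:
  assumes "f \<in> lie_automorphisms"
  shows "f (x + y) = f x + f y" "f (c *\<^sub>s x) = c *\<^sub>s f x"
    "f (sv_bracket x y) = sv_bracket (f x) (f y)" "bij f" "f 0 = 0" "f (x - y) = f x - f y" "f (- x) = - f x"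
proof -
  interpret Vector_Spaces.linear sv_scale sv_scale f
    using assms by (simp add: lie_automorphisms_def)
  show "f (x + y) = f x + f y" "f (c *\<^sub>s x) = c *\<^sub>s f x" "f 0 = 0" "f (x - y) = f x - f y"
    "f (- x) = - f x"
    by (simp_all add: add scale zero diff neg)
qed (use assms in \<open>simp_all add: lie_automorphisms_def\<close>)

lemma lie_automorphism_inv:
  assumes "f \<in> lie_automorphisms"
  shows "inv_into UNIV f \<in> lie_automorphisms"
proof (rule lie_automorphismI[where g = f])
  have f: "inj f" "\<And>y. f (inv_into UNIV f y) = y"
    using lie_automorphismD(4)[OF assms] by (simp_all add: bij_def surj_f_inv_f)
  note D = lie_automorphismD[OF assms]
  show "inv_into UNIV f (x + y) = inv_into UNIV f x + inv_into UNIV f y" "inv_into UNIV f (c *\<^sub>s x) = c *\<^sub>s inv_into UNIV f x"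
    "inv_into UNIV f (sv_bracket x y) = sv_bracket (inv_into UNIV f x) (inv_into UNIV f y)" for x y c
    by (rule injD[OF f(1)], simp add: D f(2))+
  show "inv_into UNIV f \<circ> f = id" "f \<circ> inv_into UNIV f = id"
    using f by (simp_all add: fun_eq_iff)
qed

lemma Aut_sv_simps [simp]:
  "carrier Aut_sv = lie_automorphisms" "f \<otimes>\<^bsub>Aut_sv\<^esub> g = f \<circ> g" "\<one>\<^bsub>Aut_sv\<^esub> = id"
  by (simp_all add: Aut_sv_def)

lemma lie_automorphism_comp:
  assumes "f \<in> lie_automorphisms" "g \<in> lie_automorphisms"
  shows "f \<circ> g \<in> lie_automorphisms"
  using lie_automorphismD[OF assms(1)] lie_automorphismD[OF assms(2)]
  by (simp add: lie_automorphisms_def linear_svI bij_comp)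

lemma group_Aut_sv: "group Aut_sv"
proof (rule groupI)
  show "\<one>\<^bsub>Aut_sv\<^esub> \<in> carrier Aut_sv"
    by simp (rule lie_automorphismI[where g = id]; simp)
  show "\<exists>g\<in>carrier Aut_sv. g \<otimes>\<^bsub>Aut_sv\<^esub> f = \<one>\<^bsub>Aut_sv\<^esub>" if "f \<in> carrier Aut_sv" for f
    using that lie_automorphism_inv[of f] lie_automorphismD(4)[of f]
    by (auto simp: bij_def intro!: bexI[of _ "inv_into UNIV f"])
qed (simp_all add: lie_automorphism_comp comp_assoc)

interpretation Aut_sv: group Aut_sv
  by (rule group_Aut_sv)

lemma inv_Aut_svI:
  assumes "f \<in> lie_automorphisms" "g \<in> lie_automorphisms" "g \<circ> f = id"
  shows "inv\<^bsub>Aut_sv\<^esub> f = g"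
  using Aut_sv.inv_equality[of g f] assms by simp

section \<open>Inner automorphisms as exponentials of the nilradical\<close>

lemma nexp_automorphism:
  assumes "x \<in> nilradical"
  shows "nexp x \<in> lie_automorphisms"
  using nexp_neg_compose[OF assms] nexp_bracket[OF assms]
  by (intro lie_automorphismI[where g = "nexp (- x)"]) (simp_all add: nexp_add nexp_scale)

lemma inv_nexp:
  assumes "x \<in> nilradical"
  shows "inv\<^bsub>Aut_sv\<^esub> (nexp x) = nexp (- x)"
  using assms by (intro inv_Aut_svI nexp_automorphism nexp_neg_compose nilradical_uminus)

lemma Inn_sv_eq_generate_nexp:
  "Inn_sv = generate Aut_sv {nexp (k *\<^sub>s sv_basis (Mb m) + l *\<^sub>s sv_basis (Yb n)) | k l m n. True}"
proof -
  have "exp_nilpotent (\<lambda>x. k *\<^sub>s ad (sv_basis (Mb m)) x + l *\<^sub>s ad (sv_basis (Yb n)) x) =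
      nexp (k *\<^sub>s sv_basis (Mb m) + l *\<^sub>s sv_basis (Yb n))" for k l m n
    by (subst exp_nilpotent_ad[symmetric])
      (simp_all add: nilradical_add nilradical_scale nilradical_basis ad_def sv_bracket_bilinear)
  then show ?thesis by (simp add: Inn_sv_def)
qed

text \<open>Each generator involves one \<open>M\<close> and one \<open>Y\<close> index. General
  elements are built up over their support, first in the \<open>M\<close> part, where the exponents
  simply add, and then with a central correction.\<close>

lemma Inn_sv_eq: "Inn_sv = nexp ` nilradical"
proof
  show "Inn_sv \<subseteq> nexp ` nilradical"
  proof
    fix f assume "f \<in> Inn_sv"
    then show "f \<in> nexp ` nilradical"
      unfolding Inn_sv_eq_generate_nexp
    proof (induction rule: generate.induct)
      case one
      show ?case by (auto intro: image_eqI[of _ _ 0])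
    next
      case (incl h)
      then show ?case by (auto intro!: imageI nilradical_add nilradical_scale nilradical_basis)
    next
      case (inv h)
      then obtain x where "h = nexp x" "x \<in> nilradical"
        by (auto intro!: nilradical_add nilradical_scale nilradical_basis)
      then show ?case by (simp add: inv_nexp nilradical_uminus)
    next
      case (eng h1 h2)
      then obtain x y where "h1 = nexp x" "h2 = nexp y" "x \<in> nilradical" "y \<in> nilradical"
        by blast
      then show ?case
        by (simp only: Aut_sv_simps nexp_compose)
          (intro imageI nilradical_add nilradical_scale nilradical_bracket)
    qed
  qed
  have gen: "nexp (k *\<^sub>s sv_basis (Mb m) + l *\<^sub>s sv_basis (Yb n)) \<in> Inn_sv" for k l m n
    unfolding Inn_sv_eq_generate_nexp by (rule generate.incl) blast
  have comp: "f \<circ> g \<in> Inn_sv" if "f \<in> Inn_sv" "g \<in> Inn_sv" for f g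
    using that generate.eng[of f Aut_sv _ g] by (simp add: Inn_sv_def)
  have one: "nexp 0 \<in> Inn_sv"
    using generate.one[of Aut_sv] by (simp add: Inn_sv_def)
  have central: "nexp x \<in> Inn_sv" if "x \<in> nilradical" "Yc x = 0" for x
  proof -
    \<comment> \<open>Membership in the nilradical is carried along because the addition step needs
      it for both summands.\<close>
    have "x \<in> nilradical \<and> Yc x = 0 \<and> nexp x \<in> Inn_sv"
    proof (induction x rule: sv_keys_induct)
      case (add y z)
      then have "sv_bracket y z = 0"
        by (auto intro!: sv_eqI simp: nilradical_def comps_sv_bracket)
      then have "nexp (y + z) = nexp y \<circ> nexp z" using add by (simp add: nexp_compose)
      then have "nexp (y + z) \<in> Inn_sv" using add comp[of "nexp y" "nexp z"] by metis
      with add show ?case by (simp add: nilradical_add)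
    next
      case (basis i c)
      then show ?case
        using that gen[of c _ 0]
        by (auto elim!: keys_nilradical simp: nilradical_basis nilradical_scale)
    qed (simp add: one del: nexp_zero)
    then show ?thesis by blast
  qed
  show "nexp ` nilradical \<subseteq> Inn_sv"
  proof (rule image_subsetI)
    fix x assume x: "x \<in> nilradical"
    have "x \<in> nilradical \<and> nexp x \<in> Inn_sv"
    proof (induction x rule: sv_keys_induct)
      case (add y z)
      \<comment> \<open>\<open>w\<close> lies in the \<open>M\<close> part and cancels the
        commutator term of the composition formula.\<close>
      define w where "w = (- 1 / 2) *\<^sub>s sv_bracket y z"
      have w: "w \<in> nilradical" "Yc w = 0" "sv_bracket u w = 0" if "u \<in> nilradical" for u
        using add that by (auto intro!: sv_eqI simp: w_def nilradical_def comps_sv_bracket)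
      have "nexp (y + z) = nexp y \<circ> nexp z \<circ> nexp w"
        using add w[of 0] w(3)[of "y + z + (1 / 2) *\<^sub>s sv_bracket y z"]
        by (simp add: nexp_compose nilradical_add nilradical_scale nilradical_bracket)
          (simp add: w_def)
      moreover have "nexp w \<in> Inn_sv" using w[of 0] by (simp add: central)
      ultimately have "nexp (y + z) \<in> Inn_sv" using add comp by metis
      with add show ?case by (simp add: nilradical_add)
    next
      case (basis i c)
      then show ?case
        using x gen[of c _ 0] gen[of 0 _ c]
        by (auto elim!: keys_nilradical simp: nilradical_basis nilradical_scale)
    qed (simp add: one del: nexp_zero)
    then show "nexp x \<in> Inn_sv" ..
  qed
qed

text \<open>The vanishing of the third power of \<open>ad x\<close> is expressed by the bracket
  alone, and surjectivity lets the test vector range over images.\<close>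

lemma automorphism_nilradical:
  assumes "f \<in> lie_automorphisms"
  shows "f x \<in> nilradical \<longleftrightarrow> x \<in> nilradical"
proof -
  note D = lie_automorphismD[OF assms]
  have f: "inj f" "\<And>y. \<exists>z. y = f z"
    using D(4) by (auto simp: bij_def surj_def)
  have "(\<forall>y. sv_bracket (f x) (sv_bracket (f x) (sv_bracket (f x) y)) = 0) \<longleftrightarrow>
      (\<forall>z. f (sv_bracket x (sv_bracket x (sv_bracket x z))) = f 0)"
    unfolding D using f(2) by metis
  also have "\<dots> \<longleftrightarrow> (\<forall>z. sv_bracket x (sv_bracket x (sv_bracket x z)) = 0)"
    using f(1) by (simp add: inj_eq)
  finally show ?thesis by (simp only: nilradical_iff_ad_nilpotent)
qed

lemma automorphism_nexp:
  assumes "f \<in> lie_automorphisms"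
  shows "f \<circ> nexp x = nexp (f x) \<circ> f"
  by (simp add: fun_eq_iff nexp_def lie_automorphismD[OF assms])

text \<open>Conjugation by \<open>f\<close> turns \<open>nexp x\<close> into
  \<open>nexp (f x)\<close>, and the nilradical is invariant.\<close>

lemma normal_Inn_sv: "Inn_sv \<lhd> Aut_sv"
  unfolding Aut_sv.normal_inv_iff
proof
  show "subgroup Inn_sv Aut_sv"
    unfolding Inn_sv_eq_generate_nexp
    by (rule Aut_sv.generate_is_subgroup)
      (auto intro!: nexp_automorphism nilradical_add nilradical_scale nilradical_basis)
  show "\<forall>f\<in>carrier Aut_sv. \<forall>h\<in>Inn_sv. f \<otimes>\<^bsub>Aut_sv\<^esub> h \<otimes>\<^bsub>Aut_sv\<^esub> inv\<^bsub>Aut_sv\<^esub> f \<in> Inn_sv"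
  proof (intro ballI)
    fix f h assume f: "f \<in> carrier Aut_sv" and "h \<in> Inn_sv"
    then obtain x where x: "h = nexp x" "x \<in> nilradical" by (auto simp: Inn_sv_eq)
    have "f \<otimes>\<^bsub>Aut_sv\<^esub> h \<otimes>\<^bsub>Aut_sv\<^esub> inv\<^bsub>Aut_sv\<^esub> f = nexp (f x) \<circ> (f \<circ> inv\<^bsub>Aut_sv\<^esub> f)"
      using f by (simp add: x automorphism_nexp comp_assoc)
    also have "f \<circ> inv\<^bsub>Aut_sv\<^esub> f = id" using Aut_sv.r_inv[OF f] by simp
    finally have "f \<otimes>\<^bsub>Aut_sv\<^esub> h \<otimes>\<^bsub>Aut_sv\<^esub> inv\<^bsub>Aut_sv\<^esub> f = nexp (f x)" by (simp only: comp_id)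
    moreover have "f x \<in> nilradical"
      using f x by (simp add: automorphism_nilradical)
    ultimately show "f \<otimes>\<^bsub>Aut_sv\<^esub> h \<otimes>\<^bsub>Aut_sv\<^esub> inv\<^bsub>Aut_sv\<^esub> f \<in> Inn_sv"
      unfolding Inn_sv_eq by (metis imageI)
  qed
qed

section \<open>The automorphisms \<open>sigma\<close>\<close>

lemma sigma_superset:
  assumes "finite S" "Poly_Mapping.keys x \<subseteq> S"
  shows "sigma \<epsilon> r a d x = (\<Sum>i\<in>S. Poly_Mapping.lookup x i *\<^sub>s sigma_basis \<epsilon> r a d i)"
  unfolding sigma_def using assms by (intro sum.mono_neutral_left) (auto simp: in_keys_iff)

lemma sigma_add: "sigma \<epsilon> r a d (x + y) = sigma \<epsilon> r a d x + sigma \<epsilon> r a d y"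
proof -
  let ?S = "Poly_Mapping.keys x \<union> Poly_Mapping.keys y"
  have S: "finite ?S" "Poly_Mapping.keys (x + y) \<subseteq> ?S" by (simp_all add: Poly_Mapping.keys_add)
  show ?thesis
    by (simp add: sigma_superset[OF S(1)] S(2) lookup_add sv.scale_left_distrib sum.distrib)
qed

lemma sigma_scale: "sigma \<epsilon> r a d (c *\<^sub>s x) = c *\<^sub>s sigma \<epsilon> r a d x"
  by (subst sigma_superset[OF finite_keys keys_scale]) (simp add: sigma_def sv.scale_sum_right)

lemma sigma_zero [simp]: "sigma \<epsilon> r a d 0 = 0"
  by (simp add: sigma_def)

lemma sigma_uminus: "sigma \<epsilon> r a d (- x) = - sigma \<epsilon> r a d x"
  using sigma_scale[of \<epsilon> r a d "- 1" x] by simp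

lemma sigma_diff: "sigma \<epsilon> r a d (x - y) = sigma \<epsilon> r a d x - sigma \<epsilon> r a d y"
  using sigma_add[of \<epsilon> r a d x "- y"] by (simp add: sigma_uminus)

lemma sigma_sv_basis [simp]: "sigma \<epsilon> r a d (sv_basis i) = sigma_basis \<epsilon> r a d i"
  by (simp add: sigma_def sv_basis_def)

lemma additive_sv_eqI:
  assumes "\<And>x y. f (x + y) = f x + f y" "\<And>c x. f (c *\<^sub>s x) = c *\<^sub>s f x"
    and "\<And>x y. g (x + y) = g x + g y" "\<And>c x. g (c *\<^sub>s x) = c *\<^sub>s g x"
    and "\<And>i. f (sv_basis i) = g (sv_basis i)"
  shows "f = (g :: sv \<Rightarrow> sv)"
proof
  have "f 0 = 0" "g 0 = 0" using assms(2)[of 0 0] assms(4)[of 0 0] by simp_all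
  then show "f x = g x" for x
  proof (induction x rule: sv_induct)
    case (add x y)
    then show ?case by (simp add: assms(1,3))
  next
    case (basis i c)
    show ?case by (simp only: assms(2,4,5))
  qed simp
qed


lemma power_int_twice: "x powi (n * 2) = x powi n * x powi n" for x :: "'a::division_ring"
  by (simp add: power_int_mult power2_eq_square)


text \<open>The new parameters are visible on few vectors: \<open>\<epsilon>\<close> and
  \<open>r\<close> on L_0, \<open>a\<close> on L_1, \<open>d\<close> on \<open>Yb 0\<close>. The map
  applied first sends \<open>Yb 0\<close> to index
  \<open>(\<epsilon>' - 1) div 2 - \<epsilon>' * r'\<close>, and the second contributes that power
  of \<open>a\<close>.\<close>

lemma sigma_compose_basis:
  assumes "\<epsilon> \<in> {1, - 1}" "\<epsilon>' \<in> {1, - 1}" "a \<noteq> 0" "a' \<noteq> 0"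
  shows "sigma \<epsilon> r a d (sigma_basis \<epsilon>' r' a' d' i) =
      sigma_basis (\<epsilon> * \<epsilon>') (r' + \<epsilon>' * r) (a' * a powi \<epsilon>')
        (d * d' * a powi ((\<epsilon>' - 1) div 2 - \<epsilon>' * r')) i"
proof -
  note [simp] = sigma_add sigma_diff sigma_scale sigma_uminus mult_single
    single_add[symmetric] single_diff[symmetric] single_uminus[symmetric]
  note single_cong = arg_cong2[of _ _ _ _ Poly_Mapping.single]
  consider "\<epsilon> = 1" "\<epsilon>' = 1" | "\<epsilon> = 1" "\<epsilon>' = - 1" | "\<epsilon> = - 1" "\<epsilon>' = 1" | "\<epsilon> = - 1" "\<epsilon>' = - 1"
    using assms by auto
  then show ?thesis
    by cases
      (cases i; hypsubst; rule sv_eqI; simp;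
        rule single_cong; simp add: power_int_mult_distrib power_int_divide_distrib power_int_diff power_int_add power_int_minus
          power_int_inverse power_int_twice power2_eq_square assms field_simps)+
qed

lemma sigma_compose:
  assumes "\<epsilon> \<in> {1, - 1}" "\<epsilon>' \<in> {1, - 1}" "a \<noteq> 0" "a' \<noteq> 0"
  shows "sigma \<epsilon> r a d \<circ> sigma \<epsilon>' r' a' d' =
    sigma (\<epsilon> * \<epsilon>') (r' + \<epsilon>' * r) (a' * a powi \<epsilon>') (d * d' * a powi ((\<epsilon>' - 1) div 2 - \<epsilon>' * r'))"
  by (rule additive_sv_eqI) (simp_all only: comp_apply sigma_add sigma_scale sigma_sv_basis sigma_compose_basis[OF assms])

lemma sigma_basis_bracket:
  assumes "\<epsilon> \<in> {1, - 1}" "a \<noteq> 0"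
  shows "sigma \<epsilon> r a d (basis_bracket i j) = sv_bracket (sigma_basis \<epsilon> r a d i) (sigma_basis \<epsilon> r a d j)"
proof -
  note [simp] = sigma_add sigma_diff sigma_scale sigma_uminus mult_single sv_bracket_bilinear
    single_add[symmetric] single_diff[symmetric] single_uminus[symmetric]
  note single_cong = arg_cong2[of _ _ _ _ Poly_Mapping.single]
  consider "\<epsilon> = 1" | "\<epsilon> = - 1"
    using assms by auto
  then show ?thesis
    by cases
      (cases i; cases j; hypsubst; rule sv_eqI; simp;
        rule single_cong; simp add: power_int_diff power_int_add power2_eq_square assms field_simps)+
qed

lemma sigma_bracket:
  assumes "\<epsilon> \<in> {1, - 1}" "a \<noteq> 0"
  shows "sigma \<epsilon> r a d (sv_bracket x y) = sv_bracket (sigma \<epsilon> r a d x) (sigma \<epsilon> r a d y)"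
proof (induction x rule: sv_induct)
  case (basis i c)
  show ?case
  proof (induction y rule: sv_induct)
    case (basis j c')
    show ?case
      by (simp add: sigma_scale sv_bracket_scale_left sv_bracket_scale_right sigma_basis_bracket[OF assms])
  qed (simp_all add: sigma_add sv_bracket_add_right)
qed (simp_all add: sigma_add sv_bracket_add_left)

lemma sigma_one: "sigma 1 0 1 1 = id"
proof (rule additive_sv_eqI)
  show "sigma 1 0 1 1 (sv_basis i) = id (sv_basis i)" for i
    by (cases i) simp_all
qed (simp_all add: sigma_add sigma_scale)

text \<open>The parameters of the second factor solve the composition law for the parameters 1, 0,
  1, 1 of the identity.\<close>

lemma sigma_right_inverse:
  assumes "\<epsilon> \<in> {1, - 1}" "a \<noteq> 0" "d \<noteq> 0"
  shows "sigma \<epsilon> r a d \<circ> sigma \<epsilon> (- \<epsilon> * r) (a powi - \<epsilon>) (inverse d * a powi - ((\<epsilon> - 1) div 2 + r)) = id"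
proof -
  let ?m = "(\<epsilon> - 1) div 2 + r"
  have "a powi - n * a powi n = 1" for n
    using assms(2) by (simp add: power_int_minus)
  moreover have "\<epsilon> * \<epsilon> = 1" "(\<epsilon> - 1) div 2 - \<epsilon> * (- \<epsilon> * r) = ?m" "- \<epsilon> * r + \<epsilon> * r = 0"
    using assms(1) by auto
  moreover have "d * (inverse d * u) * v = u * v" for u v
    using assms(3) by simp
  moreover have "a powi - \<epsilon> \<noteq> 0" using assms(2) by simp
  note sigma_compose[OF assms(1,1,2) this]
  ultimately show ?thesis by (simp only: sigma_one)
qed

text \<open>The right inverse is again a \<open>sigma\<close> with nonzero parameters, hence has a
  right inverse itself, and that must be the original map.\<close>

lemma sigma_inverse:
  assumes "\<epsilon> \<in> {1, - 1}" "a \<noteq> 0" "d \<noteq> 0"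
  shows "sigma \<epsilon> (- \<epsilon> * r) (a powi - \<epsilon>) (inverse d * a powi - ((\<epsilon> - 1) div 2 + r)) \<circ> sigma \<epsilon> r a d = id"
    (is "?g \<circ> ?f = id")
proof -
  have "a powi - \<epsilon> \<noteq> 0" "inverse d * a powi - ((\<epsilon> - 1) div 2 + r) \<noteq> 0"
    using assms(2,3) by auto
  then obtain h where "?g \<circ> h = id"
    using sigma_right_inverse[OF assms(1)] by blast
  moreover from this have "?f = h"
    using sigma_right_inverse[OF assms, of r] by (metis comp_assoc comp_id id_comp)
  ultimately show ?thesis by simp
qed

lemma sigma_automorphism:
  assumes "\<epsilon> \<in> {1, - 1}" "a \<noteq> 0" "d \<noteq> 0"
  shows "sigma \<epsilon> r a d \<in> lie_automorphisms"
  using sigma_right_inverse[OF assms] sigma_inverse[OF assms] sigma_bracket[OF assms(1,2)]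
  by (intro lie_automorphismI) (simp_all add: sigma_add sigma_scale)

lemma inv_sigma:
  assumes "\<epsilon> \<in> {1, - 1}" "a \<noteq> 0" "d \<noteq> 0"
  shows "inv\<^bsub>Aut_sv\<^esub> sigma \<epsilon> r a d =
    sigma \<epsilon> (- \<epsilon> * r) (a powi - \<epsilon>) (inverse d * a powi - ((\<epsilon> - 1) div 2 + r))"
  using assms by (intro inv_Aut_svI sigma_automorphism sigma_inverse) auto

lemma lookup_sv_basis: "Poly_Mapping.lookup (sv_basis i) j = (if i = j then 1 else 0)"
  by (simp add: sv_basis_def lookup_single when_def)

text \<open>Only coordinates preserved by unipotent maps are compared, so that a
  \<open>sigma\<close> known merely to be unipotent can be compared with the identity.\<close>

lemma sigma_parameters_eqI:
  assumes "\<epsilon> \<in> {1, - 1}" "\<epsilon>' \<in> {1, - 1}"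
    and "Lc (sigma \<epsilon> r a d (sv_basis (Lb 0))) = Lc (sigma \<epsilon>' r' a' d' (sv_basis (Lb 0)))"
    and "Nc (sigma \<epsilon> r a d (sv_basis (Lb 0))) = Nc (sigma \<epsilon>' r' a' d' (sv_basis (Lb 0)))"
    and "Lc (sigma \<epsilon> r a d (sv_basis (Lb 1))) = Lc (sigma \<epsilon>' r' a' d' (sv_basis (Lb 1)))"
    and "Yc (sigma \<epsilon> r a d (sv_basis (Yb 0))) = Yc (sigma \<epsilon>' r' a' d' (sv_basis (Yb 0)))"
  shows "\<epsilon> = \<epsilon>' \<and> r = r' \<and> a = a' \<and> d = d'"
proof -
  have "\<epsilon> = \<epsilon>'"
    using assms(3)[THEN arg_cong, of "\<lambda>p. Poly_Mapping.lookup p 0"]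
    by (simp add: lookup_add lookup_sv_basis lookup_of_int)
  moreover have "r = r'"
    using assms(4)[THEN arg_cong, of "\<lambda>p. Poly_Mapping.lookup p 0"]
    by (simp add: lookup_add lookup_sv_basis lookup_of_int)
  moreover have "a = a'"
    using assms(1) \<open>\<epsilon> = \<epsilon>'\<close> assms(5)[THEN arg_cong, of "\<lambda>p. Poly_Mapping.lookup p \<epsilon>"]
    by (auto simp: lookup_add lookup_sv_basis lookup_of_int)
  moreover have "d = d'"
    using \<open>\<epsilon> = \<epsilon>'\<close> \<open>r = r'\<close>
      assms(6)[THEN arg_cong, of "\<lambda>p. Poly_Mapping.lookup p (\<epsilon> * (0 - r) + (\<epsilon> - 1) div 2)"]
    by (simp add: lookup_sv_basis)
  ultimately show ?thesis by blast
qed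

lemma sigma_inject:
  assumes "\<epsilon> \<in> {1, - 1}" "\<epsilon>' \<in> {1, - 1}"
  shows "sigma \<epsilon> r a d = sigma \<epsilon>' r' a' d' \<longleftrightarrow> \<epsilon> = \<epsilon>' \<and> r = r' \<and> a = a' \<and> d = d'"
  using sigma_parameters_eqI[OF assms] by metis

text \<open>Modulo the nilradical, and modulo its derived algebra on the nilradical, inner automorphisms
  act trivially.\<close>

definition unipotent :: "(sv \<Rightarrow> sv) \<Rightarrow> bool"
  where "unipotent f \<longleftrightarrow>
    (\<forall>x. Lc (f x) = Lc x \<and> Nc (f x) = Nc x \<and> (x \<in> nilradical \<longrightarrow> Yc (f x) = Yc x))"

lemma unipotent_nexp: "x \<in> nilradical \<Longrightarrow> unipotent (nexp x)"
  by (auto simp: unipotent_def nexp_def nilradical_def comps_sv_bracket)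

text \<open>Separates the maps \<open>sigma\<close> from the inner automorphisms: the identity is
  \<open>sigma 1 0 1 1\<close>, and the parameters are unique.\<close>

lemma unipotent_sigma:
  assumes "unipotent (sigma \<epsilon> r a d)" "\<epsilon> \<in> {1, - 1}"
  shows "\<epsilon> = 1 \<and> r = 0 \<and> a = 1 \<and> d = 1"
proof -
  have "sv_basis (Yb 0) \<in> nilradical" by (rule nilradical_basis)
  with assms(1) show ?thesis
    by (intro sigma_parameters_eqI[of \<epsilon> 1 r a d 0 1 1])
      (use assms(2) in \<open>simp_all add: unipotent_def sigma_one del: sigma_sv_basis\<close>)
qed

section \<open>Internal semidirect products\<close>

text \<open>Stated with conjugation by elements of \<open>H\<close>, so that it applies at each
  level of the iterated product inside one ambient group.\<close>

lemma (in group) subgroup_set_mult: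
  assumes "subgroup H G" "subgroup K G" "\<And>h k. h \<in> H \<Longrightarrow> k \<in> K \<Longrightarrow> h \<otimes> k \<otimes> inv h \<in> K"
  shows "subgroup (H <#> K) G"
proof (rule subgroupI)
  have sub: "H \<subseteq> carrier G" "K \<subseteq> carrier G"
    using assms(1,2) by (auto dest: subgroup.subset)
  note mem = subsetD[OF sub(1)] subsetD[OF sub(2)]
    subgroup.m_closed[OF assms(1)] subgroup.m_closed[OF assms(2)]
    subgroup.m_inv_closed[OF assms(1)] subgroup.m_inv_closed[OF assms(2)]
  show "H <#> K \<subseteq> carrier G" using sub by (rule set_mult_closed)
  show "H <#> K \<noteq> {}"
    using subgroup.one_closed[OF assms(1)] subgroup.one_closed[OF assms(2)] by (auto simp: set_mult_def)
  show "inv a \<in> H <#> K" if "a \<in> H <#> K" for a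
  proof -
    from that obtain h k where hk: "h \<in> H" "k \<in> K" "a = h \<otimes> k" by (auto simp: set_mult_def)
    then have "inv a = inv h \<otimes> (h \<otimes> inv k \<otimes> inv h)"
      by (simp add: mem inv_mult_group m_assoc[symmetric])
    moreover have "h \<otimes> inv k \<otimes> inv h \<in> K" using hk by (simp add: assms(3) mem)
    ultimately show ?thesis using hk(1) by (auto simp: set_mult_def mem)
  qed
  show "a \<otimes> b \<in> H <#> K" if "a \<in> H <#> K" "b \<in> H <#> K" for a b
  proof -
    from that obtain h k h' k' where hk: "h \<in> H" "k \<in> K" "a = h \<otimes> k" "h' \<in> H" "k' \<in> K" "b = h' \<otimes> k'"
      by (auto simp: set_mult_def)
    \<comment> \<open>Here \<open>k\<close> is moved past \<open>h'\<close>; the double inverse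
      presents the result as a conjugate by \<open>inv h'\<close>, an element of
      \<open>H\<close>.\<close>
    then have "a \<otimes> b = (h \<otimes> h') \<otimes> ((inv h' \<otimes> k \<otimes> inv (inv h')) \<otimes> k')"
      by (simp add: mem m_assoc) (simp add: mem m_assoc[symmetric])
    moreover have "inv h' \<otimes> k \<otimes> inv (inv h') \<otimes> k' \<in> K" using hk by (intro assms(3) mem)
    moreover have "h \<otimes> h' \<in> H" using hk by (intro mem)
    ultimately show ?thesis unfolding set_mult_def by blast
  qed
qed

text \<open>For normality, conjugation by an element \<open>h \<otimes> l\<close> of the product is
  done in two stages, by \<open>l\<close> inside \<open>K\<close> and then by
  \<open>h\<close>.\<close>

lemma (in group) internal_semidirect_set_mult:
  assumes H: "subgroup H G" and K: "subgroup K G"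
    and conj: "\<And>h k. h \<in> H \<Longrightarrow> k \<in> K \<Longrightarrow> h \<otimes> k \<otimes> inv h \<in> K"
    and "H \<inter> K = {\<one>}"
  shows "internal_semidirect (G\<lparr>carrier := H <#> K\<rparr>) H K"
proof -
  let ?P = "G\<lparr>carrier := H <#> K\<rparr>"
  have P: "subgroup (H <#> K) G" by (rule subgroup_set_mult[OF H K conj])
  interpret P: group ?P by (rule subgroup.subgroup_is_group[OF P is_group])
  note one = subgroup.one_closed[OF H] subgroup.one_closed[OF K]
  have sub: "H \<subseteq> carrier G" "K \<subseteq> carrier G"
    using H K by (auto dest: subgroup.subset)
  have "H \<subseteq> H <#> K"
  proof
    fix h assume "h \<in> H"
    then have "h \<otimes> \<one> \<in> H <#> K" using one by (auto simp: set_mult_def)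
    with \<open>h \<in> H\<close> sub show "h \<in> H <#> K" by (simp add: subsetD)
  qed
  have "K \<subseteq> H <#> K"
  proof
    fix k assume "k \<in> K"
    then have "\<one> \<otimes> k \<in> H <#> K" using one by (auto simp: set_mult_def)
    with \<open>k \<in> K\<close> sub show "k \<in> H <#> K" by (simp add: subsetD)
  qed
  have HP: "subgroup H ?P" and KP: "subgroup K ?P"
    using \<open>H \<subseteq> H <#> K\<close> \<open>K \<subseteq> H <#> K\<close> by (auto intro: subgroup_incl H K P)
  have "x \<otimes>\<^bsub>?P\<^esub> k \<otimes>\<^bsub>?P\<^esub> inv\<^bsub>?P\<^esub> x \<in> K" if x: "x \<in> carrier ?P" and k: "k \<in> K" for x k
  proof -
    from x obtain h l where hl: "h \<in> H" "l \<in> K" "x = h \<otimes> l" by (auto simp: set_mult_def)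
    have "inv\<^bsub>?P\<^esub> x = inv x" using P x m_inv_consistent[OF P] by simp
    then have "x \<otimes>\<^bsub>?P\<^esub> k \<otimes>\<^bsub>?P\<^esub> inv\<^bsub>?P\<^esub> x = h \<otimes> (l \<otimes> k \<otimes> inv l) \<otimes> inv h"
      using hl k sub by (simp add: subsetD inv_mult_group m_assoc)
    also have "\<dots> \<in> K"
      using hl k by (intro conj subgroup.m_closed[OF K] subgroup.m_inv_closed[OF K])
    finally show ?thesis .
  qed
  then have "K \<lhd> ?P" unfolding P.normal_inv_iff using KP by blast
  then show ?thesis
    using HP assms(4) P.is_group by (simp add: internal_semidirect_def set_mult_def)
qed

section \<open>The outer automorphisms\<close>

lemma subgroup_grp_a: "subgroup grp_a Aut_sv"
proof (rule Aut_sv.subgroupI)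
  show "grp_a \<subseteq> carrier Aut_sv" by (auto simp: grp_a_def sigma_automorphism)
  show "f \<otimes>\<^bsub>Aut_sv\<^esub> g \<in> grp_a" if "f \<in> grp_a" "g \<in> grp_a" for f g
  proof -
    from that obtain \<epsilon> \<epsilon>' where "f = sigma \<epsilon> 0 1 1" "g = sigma \<epsilon>' 0 1 1" "\<epsilon> \<in> {1, - 1}" "\<epsilon>' \<in> {1, - 1}"
      by (auto simp: grp_a_def)
    then show ?thesis using sigma_compose[of \<epsilon> \<epsilon>' 1 1 0 1 0 1] by (auto simp: grp_a_def)
  qed
qed (auto simp: grp_a_def inv_sigma)

lemma subgroup_grp_t: "subgroup grp_t Aut_sv"
proof (rule Aut_sv.subgroupI)
  show "grp_t \<subseteq> carrier Aut_sv" by (auto simp: grp_t_def sigma_automorphism)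
qed (auto simp: grp_t_def inv_sigma sigma_compose simp del: comp_apply)

lemma subgroup_grp_b: "subgroup grp_b Aut_sv"
proof (rule Aut_sv.subgroupI)
  show "grp_b \<subseteq> carrier Aut_sv" by (auto simp: grp_b_def sigma_automorphism)
  show "inv\<^bsub>Aut_sv\<^esub> f \<in> grp_b" if "f \<in> grp_b" for f
  proof -
    from that obtain a d where "f = sigma 1 0 a d" "a \<noteq> 0" "d \<noteq> 0" by (auto simp: grp_b_def)
    then have "inv\<^bsub>Aut_sv\<^esub> f = sigma 1 0 (inverse a) (inverse d)" "inverse a \<noteq> 0" "inverse d \<noteq> 0"
      by (simp_all add: inv_sigma power_int_minus)
    then show ?thesis unfolding grp_b_def by blast
  qed
  show "f \<otimes>\<^bsub>Aut_sv\<^esub> g \<in> grp_b" if "f \<in> grp_b" "g \<in> grp_b" for f g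
  proof -
    from that obtain a d a' d' where "f = sigma 1 0 a d" "a \<noteq> 0" "d \<noteq> 0"
        "g = sigma 1 0 a' d'" "a' \<noteq> 0" "d' \<noteq> 0"
      by (auto simp: grp_b_def)
    then have "f \<otimes>\<^bsub>Aut_sv\<^esub> g = sigma 1 0 (a' * a) (d * d')" "a' * a \<noteq> 0" "d * d' \<noteq> 0"
      by (simp_all add: sigma_compose del: comp_apply)
    then show ?thesis unfolding grp_b_def by blast
  qed
qed (auto simp: grp_b_def intro: exI[of _ 1])

text \<open>Every \<open>sigma\<close> is a product of one factor from each of the three groups in
  the order a, t, b, which makes the product sets explicit.\<close>

lemma sigma_mult_sigma:
  assumes "\<epsilon> \<in> {1, - 1}" "a \<noteq> 0"
  shows "sigma \<epsilon> 0 1 1 \<circ> sigma 1 r 1 1 = sigma \<epsilon> r 1 1"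
    and "sigma \<epsilon> r 1 1 \<circ> sigma 1 0 a d = sigma \<epsilon> r a d"
  using sigma_compose[OF assms(1), of 1 1 1 0 1 r 1] sigma_compose[OF assms(1), of 1 1 a r 1 0 d] assms(2)
  by simp_all

lemma grp_a_mult_grp_t: "grp_a <#>\<^bsub>Aut_sv\<^esub> grp_t = {sigma \<epsilon> r 1 1 | \<epsilon> r. \<epsilon> \<in> {1, - 1}}"
proof -
  have "grp_a <#>\<^bsub>Aut_sv\<^esub> grp_t = {sigma \<epsilon> 0 1 1 \<circ> sigma 1 r 1 1 | \<epsilon> r. \<epsilon> \<in> {1, - 1}}"
    unfolding set_mult_def grp_a_def grp_t_def Aut_sv_simps by blast
  also have "\<dots> = {sigma \<epsilon> r 1 1 | \<epsilon> r. \<epsilon> \<in> {1, - 1}}"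
    using sigma_mult_sigma(1) zero_neq_one by (metis (lifting))
  finally show ?thesis .
qed

lemma grp_at_mult_grp_b:
  "grp_a <#>\<^bsub>Aut_sv\<^esub> grp_t <#>\<^bsub>Aut_sv\<^esub> grp_b =
    {sigma \<epsilon> r a d | \<epsilon> r a d. \<epsilon> \<in> {1, - 1} \<and> a \<noteq> 0 \<and> d \<noteq> 0}"
proof -
  have "grp_a <#>\<^bsub>Aut_sv\<^esub> grp_t <#>\<^bsub>Aut_sv\<^esub> grp_b =
      {sigma \<epsilon> r 1 1 \<circ> sigma 1 0 a d | \<epsilon> r a d. \<epsilon> \<in> {1, - 1} \<and> a \<noteq> 0 \<and> d \<noteq> 0}"
    unfolding grp_a_mult_grp_t unfolding set_mult_def grp_b_def Aut_sv_simps by blast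
  also have "\<dots> = {sigma \<epsilon> r a d | \<epsilon> r a d. \<epsilon> \<in> {1, - 1} \<and> a \<noteq> 0 \<and> d \<noteq> 0}"
    using sigma_mult_sigma(2) by (metis (lifting))
  finally show ?thesis .
qed

text \<open>Conjugation by a sign replaces \<open>r\<close> by
  \<open>\<epsilon> * r\<close>.\<close>

lemma grp_t_conj:
  assumes "h \<in> grp_a" "k \<in> grp_t"
  shows "h \<otimes>\<^bsub>Aut_sv\<^esub> k \<otimes>\<^bsub>Aut_sv\<^esub> inv\<^bsub>Aut_sv\<^esub> h \<in> grp_t"
proof -
  obtain \<epsilon> r where hk: "h = sigma \<epsilon> 0 1 1" "k = sigma 1 r 1 1" "\<epsilon> \<in> {1, - 1}"
    using assms by (auto simp: grp_a_def grp_t_def)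
  then have "inv\<^bsub>Aut_sv\<^esub> h = sigma \<epsilon> 0 1 1" by (simp add: inv_sigma)
  with hk have "h \<otimes>\<^bsub>Aut_sv\<^esub> k \<otimes>\<^bsub>Aut_sv\<^esub> inv\<^bsub>Aut_sv\<^esub> h = sigma \<epsilon> r 1 1 \<circ> sigma \<epsilon> 0 1 1"
    by (simp add: sigma_mult_sigma(1)[OF hk(3) zero_neq_one[symmetric]] del: comp_apply)
  also have "\<dots> = sigma 1 (\<epsilon> * r) 1 1"
    using sigma_compose[OF hk(3,3), of 1 1 r 1 0 1] hk(3) by auto
  finally show ?thesis unfolding grp_t_def by blast
qed

text \<open>Conjugation raises \<open>a\<close> to the power \<open>\<epsilon>\<close> and
  multiplies \<open>d\<close> by a power of \<open>a\<close>, so both stay nonzero.\<close>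

lemma grp_b_conj:
  assumes "h \<in> grp_a <#>\<^bsub>Aut_sv\<^esub> grp_t" "k \<in> grp_b"
  shows "h \<otimes>\<^bsub>Aut_sv\<^esub> k \<otimes>\<^bsub>Aut_sv\<^esub> inv\<^bsub>Aut_sv\<^esub> h \<in> grp_b"
proof -
  obtain \<epsilon> r a d where hk: "h = sigma \<epsilon> r 1 1" "k = sigma 1 0 a d" "\<epsilon> \<in> {1, - 1}" "a \<noteq> 0" "d \<noteq> 0"
    using assms by (auto simp: grp_a_mult_grp_t grp_b_def)
  then have "inv\<^bsub>Aut_sv\<^esub> h = sigma \<epsilon> (- \<epsilon> * r) 1 1" by (simp add: inv_sigma)
  with hk have "h \<otimes>\<^bsub>Aut_sv\<^esub> k \<otimes>\<^bsub>Aut_sv\<^esub> inv\<^bsub>Aut_sv\<^esub> h = sigma \<epsilon> r a d \<circ> sigma \<epsilon> (- \<epsilon> * r) 1 1"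
    by (simp add: sigma_mult_sigma(2)[OF hk(3,4)] del: comp_apply)
  also have "\<dots> = sigma 1 0 (a powi \<epsilon>) (d * a powi ((\<epsilon> - 1) div 2 - \<epsilon> * (- \<epsilon> * r)))"
    using sigma_compose[OF hk(3,3,4), of 1 r d "- \<epsilon> * r" 1] hk(3) by auto
  finally show ?thesis
    using hk(4,5) unfolding grp_b_def by (auto intro!: exI)
qed

section \<open>Isomorphism types of the three factors\<close>

lemma group_sign_group: "group sign_group"
  by (rule groupI) (auto simp: sign_group_def)

lemma group_complex_units: "group complex_units"
proof (rule groupI)
  show "\<exists>y\<in>carrier complex_units. y \<otimes>\<^bsub>complex_units\<^esub> x = \<one>\<^bsub>complex_units\<^esub>"
    if "x \<in> carrier complex_units" for x
    using that by (intro bexI[of _ "inverse x"]) (auto simp: complex_units_def)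
qed (auto simp: complex_units_def)

lemma grp_a_iso: "Aut_sv\<lparr>carrier := grp_a\<rparr> \<cong> sign_group"
proof (rule group.iso_sym[OF group_sign_group is_isoI])
  show "(\<lambda>\<epsilon>. sigma \<epsilon> 0 1 1) \<in> iso sign_group (Aut_sv\<lparr>carrier := grp_a\<rparr>)"
  proof (rule isoI)
    show "(\<lambda>\<epsilon>. sigma \<epsilon> 0 1 1) \<in> hom sign_group (Aut_sv\<lparr>carrier := grp_a\<rparr>)"
      by (rule homI) (auto simp: sign_group_def grp_a_def sigma_compose simp del: comp_apply)
    show "bij_betw (\<lambda>\<epsilon>. sigma \<epsilon> 0 1 1) (carrier sign_group) (carrier (Aut_sv\<lparr>carrier := grp_a\<rparr>))"
      by (auto simp: bij_betw_def inj_on_def sign_group_def grp_a_def sigma_inject)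
  qed
qed

lemma grp_t_iso: "Aut_sv\<lparr>carrier := grp_t\<rparr> \<cong> integer_group"
proof (rule group.iso_sym[OF group_integer_group is_isoI])
  show "(\<lambda>r. sigma 1 r 1 1) \<in> iso integer_group (Aut_sv\<lparr>carrier := grp_t\<rparr>)"
  proof (rule isoI)
    show "(\<lambda>r. sigma 1 r 1 1) \<in> hom integer_group (Aut_sv\<lparr>carrier := grp_t\<rparr>)"
      by (rule homI) (auto simp: grp_t_def sigma_compose add.commute simp del: comp_apply)
    show "bij_betw (\<lambda>r. sigma 1 r 1 1) (carrier integer_group) (carrier (Aut_sv\<lparr>carrier := grp_t\<rparr>))"
      by (auto simp: bij_betw_def inj_on_def grp_t_def sigma_inject)
  qed
qed

text \<open>For \<open>\<epsilon> = 1\<close> and \<open>r = 0\<close> the power of \<open>a\<close>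
  that multiplies \<open>d\<close> in the composition law is trivial, so the parameters multiply
  separately.\<close>

lemma grp_b_iso: "Aut_sv\<lparr>carrier := grp_b\<rparr> \<cong> complex_units \<times>\<times> complex_units"
proof (rule group.iso_sym[OF DirProd_group[OF group_complex_units group_complex_units] is_isoI])
  let ?f = "\<lambda>(a, d). sigma 1 0 a d"
  show "?f \<in> iso (complex_units \<times>\<times> complex_units) (Aut_sv\<lparr>carrier := grp_b\<rparr>)"
  proof (rule isoI)
    show "?f \<in> hom (complex_units \<times>\<times> complex_units) (Aut_sv\<lparr>carrier := grp_b\<rparr>)"
    proof (rule homI)
      fix x y assume "x \<in> carrier (complex_units \<times>\<times> complex_units)" "y \<in> carrier (complex_units \<times>\<times> complex_units)"
      then show "?f (x \<otimes>\<^bsub>complex_units \<times>\<times> complex_units\<^esub> y) = ?f x \<otimes>\<^bsub>Aut_sv\<lparr>carrier := grp_b\<rparr>\<^esub> ?f y"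
        by (auto simp: complex_units_def DirProd_def sigma_compose mult.commute simp del: comp_apply)
    qed (auto simp: complex_units_def DirProd_def grp_b_def)
    show "bij_betw ?f (carrier (complex_units \<times>\<times> complex_units)) (carrier (Aut_sv\<lparr>carrier := grp_b\<rparr>))"
      by (auto simp: bij_betw_def inj_on_def complex_units_def DirProd_def grp_b_def sigma_inject image_iff)
  qed
qed

text \<open>The first two come from uniqueness of the parameters, the third from the unipotence of
  inner automorphisms.\<close>

lemma grp_inter:
  "grp_a \<inter> grp_t = {id}" "(grp_a <#>\<^bsub>Aut_sv\<^esub> grp_t) \<inter> grp_b = {id}"
  "(grp_a <#>\<^bsub>Aut_sv\<^esub> grp_t <#>\<^bsub>Aut_sv\<^esub> grp_b) \<inter> Inn_sv = {id}"
proof -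
  have "id \<in> Inn_sv" unfolding Inn_sv_eq by (metis imageI nexp_zero nilradical_zero)
  have id: "id = sigma 1 0 1 1" by (simp add: sigma_one)
  show "grp_a \<inter> grp_t = {id}"
  proof
    show "grp_a \<inter> grp_t \<subseteq> {id}"
    proof
      fix f assume "f \<in> grp_a \<inter> grp_t"
      then obtain \<epsilon> r where "f = sigma \<epsilon> 0 1 1" "f = sigma 1 r 1 1" "\<epsilon> \<in> {1, - 1}"
        by (auto simp: grp_a_def grp_t_def)
      moreover from this have "r = 0" using sigma_inject[of \<epsilon> 1 0 1 1 r 1 1] by simp
      ultimately show "f \<in> {id}" by (simp add: id)
    qed
  qed (simp add: subgroup.one_closed[OF subgroup_grp_a, simplified] subgroup.one_closed[OF subgroup_grp_t, simplified])
  show "(grp_a <#>\<^bsub>Aut_sv\<^esub> grp_t) \<inter> grp_b = {id}"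
  proof
    show "(grp_a <#>\<^bsub>Aut_sv\<^esub> grp_t) \<inter> grp_b \<subseteq> {id}"
    proof
      fix f assume "f \<in> (grp_a <#>\<^bsub>Aut_sv\<^esub> grp_t) \<inter> grp_b"
      then obtain \<epsilon> r a d where "f = sigma \<epsilon> r 1 1" "f = sigma 1 0 a d" "\<epsilon> \<in> {1, - 1}"
        unfolding grp_a_mult_grp_t grp_b_def by blast
      moreover from this have "a = 1 \<and> d = 1" using sigma_inject[of \<epsilon> 1 r 1 1 0 a d] by simp
      ultimately show "f \<in> {id}" by (simp add: id)
    qed
    have "id \<in> grp_a <#>\<^bsub>Aut_sv\<^esub> grp_t"
      unfolding grp_a_mult_grp_t mem_Collect_eq by (rule exI[of _ 1], rule exI[of _ 0]) (simp add: id)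
    then show "{id} \<subseteq> (grp_a <#>\<^bsub>Aut_sv\<^esub> grp_t) \<inter> grp_b"
      by (simp add: subgroup.one_closed[OF subgroup_grp_b, simplified])
  qed
  show "(grp_a <#>\<^bsub>Aut_sv\<^esub> grp_t <#>\<^bsub>Aut_sv\<^esub> grp_b) \<inter> Inn_sv = {id}"
  proof
    have "id \<in> grp_a <#>\<^bsub>Aut_sv\<^esub> grp_t <#>\<^bsub>Aut_sv\<^esub> grp_b"
      unfolding grp_at_mult_grp_b mem_Collect_eq
      by (rule exI[of _ 1], rule exI[of _ 0], rule exI[of _ 1], rule exI[of _ 1]) (simp add: id)
    then show "{id} \<subseteq> (grp_a <#>\<^bsub>Aut_sv\<^esub> grp_t <#>\<^bsub>Aut_sv\<^esub> grp_b) \<inter> Inn_sv"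
      using \<open>id \<in> Inn_sv\<close> by simp
    show "(grp_a <#>\<^bsub>Aut_sv\<^esub> grp_t <#>\<^bsub>Aut_sv\<^esub> grp_b) \<inter> Inn_sv \<subseteq> {id}"
    proof
      fix f assume f: "f \<in> (grp_a <#>\<^bsub>Aut_sv\<^esub> grp_t <#>\<^bsub>Aut_sv\<^esub> grp_b) \<inter> Inn_sv"
      then obtain \<epsilon> r a d where sigma: "f = sigma \<epsilon> r a d" "\<epsilon> \<in> {1, - 1}"
        unfolding grp_at_mult_grp_b by blast
      have "unipotent f" using f by (auto simp: Inn_sv_eq unipotent_nexp)
      then have "\<epsilon> = 1 \<and> r = 0 \<and> a = 1 \<and> d = 1"
        using unipotent_sigma sigma by metis
      then show "f \<in> {id}" by (simp add: sigma sigma_one)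
    qed
  qed
qed

section \<open>Every automorphism is a \<open>sigma\<close> up to an inner one\<close>

lemma single_eq_zero_iff [simp]: "Poly_Mapping.single k c = 0 \<longleftrightarrow> c = 0"
  by (metis lookup_single_eq lookup_zero single_zero)

lemma laurent_constantI:
  assumes "bounded_by 1 0 p" "bounded_by (- 1) 0 p"
  shows "p = cst (Poly_Mapping.lookup p 0)"
proof (rule poly_mapping_eqI)
  show "Poly_Mapping.lookup p n = Poly_Mapping.lookup (cst (Poly_Mapping.lookup p 0)) n" for n
    using assms by (cases n "0 :: int" rule: linorder_cases) (auto simp: bounded_by_lookup lookup_single)
qed

lemma laurent_monomialI:
  assumes "\<And>n. Poly_Mapping.lookup p n \<noteq> 0 \<Longrightarrow> n = k"
  shows "p = Poly_Mapping.single k (Poly_Mapping.lookup p k)"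
  by (rule poly_mapping_eqI) (metis assms lookup_single_eq lookup_single_not_eq)

text \<open>\<open>u\<close> is the logarithmic derivative of \<open>h\<close>. Comparing leading
  terms at both ends bounds \<open>u\<close> by degree 0, so it is a constant, and this constant
  equals every exponent of \<open>h\<close>.\<close>

lemma euler_logarithmic:
  assumes "h \<noteq> 0" "euler h = u * h"
  obtains k d where "d \<noteq> 0" "h = Poly_Mapping.single k d" "u = of_int k"
proof -
  have bounded: "bounded_by s 0 u" if s: "s * s = 1" for s
  proof (cases "u = 0")
    case False
    obtain m where m: "bounded_by s m h" "Poly_Mapping.lookup h m \<noteq> 0"
      using leading_exponent assms(1) s by metis
    obtain k where k: "bounded_by s k u" "Poly_Mapping.lookup u k \<noteq> 0"
      using leading_exponent False s by metis
    have "Poly_Mapping.lookup (euler h) (k + m) \<noteq> 0"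
      using lookup_times_leading[OF k(1) m(1) s] k(2) m(2) assms(2) by simp
    then have "s * (k + m) \<le> s * m"
      using bounded_by_euler[OF m(1)] by (meson bounded_by_lookup not_le)
    then have "s * k \<le> s * 0" by (simp add: distrib_left)
    then show ?thesis using k(1) by (auto simp: bounded_by_def intro: order_trans)
  qed simp
  define c where "c = Poly_Mapping.lookup u 0"
  have u: "u = cst c"
    unfolding c_def by (intro laurent_constantI bounded) simp_all
  have eig: "of_int n = c" if "Poly_Mapping.lookup h n \<noteq> 0" for n
    using that arg_cong[OF assms(2), of "\<lambda>p. Poly_Mapping.lookup p n"] by (simp add: u)
  obtain k where k: "Poly_Mapping.lookup h k \<noteq> 0"
    using assms(1) by (metis poly_mapping_eqI lookup_zero)
  then have "h = Poly_Mapping.single k (Poly_Mapping.lookup h k)"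
    by (intro laurent_monomialI) (metis eig of_int_eq_iff)
  moreover have "u = of_int k" using eig[OF k] u by (metis single_of_int)
  ultimately show ?thesis using that k by blast
qed

text \<open>The structure constants \<open>n - m\<close> of the Witt algebra give no information for
  \<open>m = n\<close>, hence the restricted form of multiplicativity.\<close>

lemma power_int_characterI:
  fixes \<beta> :: "int \<Rightarrow> complex"
  assumes "\<beta> 0 = 1" and mult: "\<And>m n. m \<noteq> n \<Longrightarrow> \<beta> (m + n) = \<beta> m * \<beta> n"
  obtains a where "a \<noteq> 0" "\<And>n. \<beta> n = a powi n"
proof -
  define a where "a = \<beta> 1"
  have nz: "\<beta> n \<noteq> 0" for n
    using mult[of n "- n"] assms(1) by (cases "n = 0") auto
  \<comment> \<open>Two evaluations of \<open>\<beta> 5\<close>, as \<open>\<beta> (4 + 1)\<close>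
    and \<open>\<beta> (3 + 2)\<close>, supply the missing value \<open>\<beta> 2\<close>.\<close>
  have "\<beta> 2 * \<beta> 1 ^ 3 = \<beta> 2 ^ 2 * \<beta> 1"
    using mult[of 2 1] mult[of 3 1] mult[of 4 1] mult[of 3 2]
    by (simp add: power2_eq_square power3_eq_cube algebra_simps)
  then have "\<beta> 2 = a * a"
    using nz[of 1] nz[of 2] by (simp add: a_def power2_eq_square power3_eq_cube)
  then have step: "\<beta> (n + 1) = \<beta> n * a" for n
    using mult[of n 1] by (cases "n = 1") (simp_all add: a_def)
  have "a \<noteq> 0" using nz by (simp add: a_def)
  have "\<beta> n = a powi n" for n
  proof (induction n rule: int_induct[where k = 0])
    case (step1 i)
    then show ?case using step[of i] \<open>a \<noteq> 0\<close> by (simp add: power_int_add)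
  next
    case (step2 i)
    then show ?case using step[of "i - 1"] \<open>a \<noteq> 0\<close> by (simp add: power_int_diff field_simps)
  qed (simp add: assms(1))
  with \<open>a \<noteq> 0\<close> show ?thesis using that by blast
qed

text \<open>By surjectivity the images of the basis span the algebra, so a linear condition on them
  holds for every vector.\<close>

lemma automorphism_span:
  assumes f: "f \<in> lie_automorphisms"
    and "P 0" "\<And>x y. P x \<Longrightarrow> P y \<Longrightarrow> P (x + y)" "\<And>i c. P (c *\<^sub>s f (sv_basis i))"
  shows "P y"
proof -
  have "P (f x)" for x
    by (induction x rule: sv_induct) (simp_all add: assms lie_automorphismD[OF f])
  moreover obtain x where "y = f x"
    using lie_automorphismD(4)[OF f] by (metis bij_pointE)
  ultimately show ?thesis by simp
qed

lemma automorphism_basis_bracket: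
  assumes "f \<in> lie_automorphisms"
  shows "f (basis_bracket i j) = sv_bracket (f (sv_basis i)) (f (sv_basis j))"
  by (simp only: lie_automorphismD(3)[OF assms] flip: sv_bracket_basis)

lemma automorphism_nilradical_Lc_Nc:
  assumes "f \<in> lie_automorphisms"
  shows "Lc (f (sv_basis (Mb n))) = 0" "Nc (f (sv_basis (Mb n))) = 0"
    "Lc (f (sv_basis (Yb n))) = 0" "Nc (f (sv_basis (Yb n))) = 0"
proof -
  have "f (sv_basis (Mb n)) \<in> nilradical" "f (sv_basis (Yb n)) \<in> nilradical"
    by (simp_all only: automorphism_nilradical[OF assms] nilradical_basis)
  then show "Lc (f (sv_basis (Mb n))) = 0" "Nc (f (sv_basis (Mb n))) = 0"
    "Lc (f (sv_basis (Yb n))) = 0" "Nc (f (sv_basis (Yb n))) = 0"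
    by (simp_all add: nilradical_def)
qed

text \<open>The \<open>M\<close> part is the derived algebra of the nilradical, so automorphisms are
  controlled there by their values on \<open>Y\<close>.\<close>

lemma Mb_as_bracket: "\<exists>i j c. sv_basis (Mb n) = c *\<^sub>s sv_bracket (sv_basis (Yb i)) (sv_basis (Yb j))"
proof -
  \<comment> \<open>For \<open>j = - 1\<close> the coefficient \<open>k\<close> is
    \<open>n + 1\<close>; the case \<open>n = - 1\<close> needs the second choice, which gives
    \<open>k = 2\<close>.\<close>
  define j where "j = (if n = - 1 then - 2 else - 1 :: int)"
  define k where "k = n - 2 * j - 1"
  have k: "n - 1 - j - j = k" "n - 1 - j + j + 1 = n" by (simp_all add: k_def)
  have "k \<noteq> 0" by (simp add: k_def j_def)
  then have "(1 / of_int k) *\<^sub>s sv_bracket (sv_basis (Yb (n - 1 - j))) (sv_basis (Yb j)) = sv_basis (Mb n)"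
    by (simp only: sv_bracket_basis basis_bracket.simps k sv.scale_scale) simp
  then show ?thesis by metis
qed

lemma automorphism_Yc_zero:
  assumes f: "f \<in> lie_automorphisms" and x: "x \<in> nilradical" "Yc x = 0"
  shows "Yc (f x) = 0"
proof -
  have *: "Yc (f (sv_basis (Mb n))) = 0" for n
  proof -
    obtain i j c where "sv_basis (Mb n) = c *\<^sub>s sv_bracket (sv_basis (Yb i)) (sv_basis (Yb j))"
      using Mb_as_bracket by blast
    then show ?thesis
      by (simp only: lie_automorphismD[OF f] comps_sv_bracket comps_scale)
        (simp add: automorphism_nilradical_Lc_Nc[OF f])
  qed
  show ?thesis
  proof (induction x rule: sv_keys_induct)
    case (basis i c)
    with x obtain n where "i = Mb n" by (elim keys_nilradical) simp_all
    then show ?case by (simp add: lie_automorphismD[OF f] *)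
  next
    case (add y z)
    then show ?case by (simp add: lie_automorphismD(1)[OF f])
  qed (simp add: lie_automorphismD(5)[OF f])
qed

section \<open>The automorphism induced on the Witt algebra quotient\<close>

fun weight :: "sv_index \<Rightarrow> complex" where
  "weight (Lb n) = of_int n"
| "weight (Mb n) = of_int n"
| "weight (Nb n) = of_int n"
| "weight (Yb n) = of_int n + 1 / 2"

lemma basis_bracket_L0: "basis_bracket (Lb 0) i = weight i *\<^sub>s sv_basis i"
  by (cases i) simp_all

text \<open>All vectors \<open>f (sv_basis i)\<close> are eigenvectors of \<open>ad (f L\<^sub>0)\<close>. If the \<open>L\<close>-part of
  \<open>f L\<^sub>0\<close> were not constant, the degrees of all their \<open>L\<close>-parts would be bounded on one side,
  contradicting surjectivity.\<close>

lemma automorphism_L0_constant: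
  assumes f: "f \<in> lie_automorphisms"
  obtains c where "c \<noteq> 0" "Lc (f (sv_basis (Lb 0))) = cst c"
proof -
  define u where "u = Lc (f (sv_basis (Lb 0)))"
  define p where "p i = Lc (f (sv_basis i))" for i
  have eig: "u * euler (p i) - p i * euler u = cst (weight i) * p i" for i
    using automorphism_basis_bracket[OF f, of "Lb 0" i, THEN arg_cong, of Lc]
    by (simp add: basis_bracket_L0 lie_automorphismD[OF f] comps_sv_bracket u_def p_def)
  have "u \<noteq> 0"
  proof
    assume "u = 0"
    then have nz: "p i = 0" if "weight i \<noteq> 0" for i
      using eig[of i] that by simp
    \<comment> \<open>N_0 has weight 0 and escapes the eigenvalue argument, but it is a multiple of
      the bracket of L_1 and N_-1, which have nonzero weight.\<close>
    have "p (Nb 0) = 0"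
      using automorphism_basis_bracket[OF f, of "Lb 1" "Nb (- 1)", THEN arg_cong, of Lc]
        nz[of "Lb 1"] nz[of "Nb (- 1)"]
      by (simp add: lie_automorphismD[OF f] comps_sv_bracket p_def)
    moreover have "p (Lb 0) = 0" using \<open>u = 0\<close> by (simp add: u_def p_def)
    moreover have "p (Mb n) = 0" "p (Yb n) = 0" for n
      using automorphism_nilradical_Lc_Nc[OF f] by (simp_all add: p_def)
    ultimately have p: "p i = 0" for i
      using nz[of i] by (cases i) (metis weight.simps of_int_eq_0_iff)+
    have "Lc y = 0" for y
      by (rule automorphism_span[OF f, where P = "\<lambda>y. Lc y = 0"]) (simp_all add: p[unfolded p_def])
    from this[of "sv_basis (Lb 0)"] show False by simp
  qed
  have bounded: "bounded_by s 0 u" if s: "s * s = 1" for s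
  proof -
    obtain k where k: "bounded_by s k u" "Poly_Mapping.lookup u k \<noteq> 0"
      using leading_exponent[OF \<open>u \<noteq> 0\<close> s] .
    have "k = 0"
    proof (rule ccontr)
      assume "k \<noteq> 0"
      then have p: "bounded_by s k (p i)" for i
        using witt_eigenvector_bounded[OF k _ s eig] by blast
      have "bounded_by s k (Lc y)" for y
        by (rule automorphism_span[OF f, where P = "\<lambda>y. bounded_by s k (Lc y)"])
          (simp_all add: p[unfolded p_def] bounded_by_add bounded_by_cst)
      \<comment> \<open>This basis vector lies one step beyond the bound.\<close>
      from this[of "sv_basis (Lb (k + s))"] have "s * (k + s) \<le> s * k"
        by (simp add: bounded_by_def del: mult_le_cancel_left)
      then show False using s by (simp add: distrib_left)
    qed
    then show ?thesis using k(1) by simp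
  qed
  have "u = cst (Poly_Mapping.lookup u 0)"
    by (intro laurent_constantI bounded) simp_all
  with \<open>u \<noteq> 0\<close> show ?thesis using that[of "Poly_Mapping.lookup u 0"]
    by (metis single_zero u_def)
qed

lemma automorphism_L0_weight:
  assumes f: "f \<in> lie_automorphisms" and c: "Lc (f (sv_basis (Lb 0))) = cst c"
    and "Poly_Mapping.lookup (Lc (f (sv_basis i))) j \<noteq> 0"
  shows "c * of_int j = weight i"
proof -
  let ?p = "Lc (f (sv_basis i))"
  have "cst c * euler ?p = cst (weight i) * ?p"
    using automorphism_basis_bracket[OF f, of "Lb 0" i, THEN arg_cong, of Lc]
    by (simp add: basis_bracket_L0 lie_automorphismD[OF f] comps_sv_bracket c)
  from arg_cong[OF this, of "\<lambda>q. Poly_Mapping.lookup q j"] show ?thesis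
    using assms(3) by simp
qed

text \<open>Surjectivity forces exponent 1 to occur, which makes \<open>c\<close> an integer; an
  exponent \<open>j\<close> in the image of L_1 satisfies \<open>c * j = 1\<close>. Hence
  \<open>c\<close> is a unit of the integers.\<close>

lemma automorphism_L0_sign:
  assumes f: "f \<in> lie_automorphisms"
  obtains \<epsilon> where "\<epsilon> \<in> {1, - 1}" "Lc (f (sv_basis (Lb 0))) = of_int \<epsilon>"
proof -
  obtain c where c: "c \<noteq> 0" "Lc (f (sv_basis (Lb 0))) = cst c"
    using automorphism_L0_constant[OF f] .
  note weight = automorphism_L0_weight[OF f c(2)]
  have "Lc (f (sv_basis (Lb 1))) \<noteq> 0"
  proof
    assume "Lc (f (sv_basis (Lb 1))) = 0"
    then have "cst (- 2) * Lc (f (sv_basis (Lb 0))) = 0"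
      using automorphism_basis_bracket[OF f, of "Lb 1" "Lb (- 1)", THEN arg_cong, of Lc]
      by (simp add: lie_automorphismD[OF f] comps_sv_bracket del: c)
    then show False using c by simp
  qed
  then obtain j where j: "Poly_Mapping.lookup (Lc (f (sv_basis (Lb 1)))) j \<noteq> 0"
    by (metis poly_mapping_eqI lookup_zero)
  have "\<exists>i. Poly_Mapping.lookup (Lc (f (sv_basis i))) 1 \<noteq> 0"
  proof (rule ccontr)
    assume *: "\<nexists>i. Poly_Mapping.lookup (Lc (f (sv_basis i))) 1 \<noteq> 0"
    have "Poly_Mapping.lookup (Lc y) 1 = 0" for y
      by (rule automorphism_span[OF f, where P = "\<lambda>y. Poly_Mapping.lookup (Lc y) 1 = 0"])
        (use * in \<open>simp_all add: lookup_add del: lookup_comps\<close>)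
    from this[of "sv_basis (Lb 1)"] show False by (simp add: lookup_sv_basis)
  qed
  then obtain i where i: "Poly_Mapping.lookup (Lc (f (sv_basis i))) 1 \<noteq> 0" by blast
  \<comment> \<open>Half-integral weights are excluded, since the \<open>Y\<close> basis vectors are
    sent into the nilradical.\<close>
  then obtain n where n: "weight i = of_int n"
    using automorphism_nilradical_Lc_Nc[OF f] by (cases i) (auto simp del: lookup_comps)
  have "c = of_int n" using weight[OF i] n by simp
  moreover from this have "n * j = 1"
    using weight[OF j] by (metis of_int_1 of_int_eq_iff of_int_mult weight.simps(1))
  ultimately show ?thesis
    using that[of n] c(2) by (auto simp: zmult_eq_1_iff)
qed

text \<open>Comparing weights makes the \<open>L\<close> part of the image of L_n a monomial; its
  coefficient is a sign times a character of the integers.\<close>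

lemma automorphism_witt:
  assumes f: "f \<in> lie_automorphisms"
  obtains \<epsilon> a where "\<epsilon> \<in> {1, - 1}" "a \<noteq> 0"
    "\<And>n. Lc (f (sv_basis (Lb n))) = Lc (sigma \<epsilon> 0 a 1 (sv_basis (Lb n)))"
proof -
  obtain \<epsilon> where \<epsilon>: "\<epsilon> \<in> {1, - 1}" "Lc (f (sv_basis (Lb 0))) = of_int \<epsilon>"
    using automorphism_L0_sign[OF f] .
  have \<epsilon>2: "\<epsilon> * \<epsilon> = 1" "of_int \<epsilon> * of_int \<epsilon> = (1 :: complex)" using \<epsilon>(1) by auto
  define b where "b n = Poly_Mapping.lookup (Lc (f (sv_basis (Lb n)))) (\<epsilon> * n)" for n
  have p: "Lc (f (sv_basis (Lb n))) = Poly_Mapping.single (\<epsilon> * n) (b n)" for n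
    unfolding b_def
  proof (rule laurent_monomialI)
    fix j assume "Poly_Mapping.lookup (Lc (f (sv_basis (Lb n)))) j \<noteq> 0"
    then have "(of_int \<epsilon> * of_int j :: complex) = of_int n"
      using automorphism_L0_weight[OF f, of "of_int \<epsilon>" "Lb n" j] \<epsilon>(2) by (simp del: lookup_comps)
    then have "\<epsilon> * j = n" by (metis of_int_eq_iff of_int_mult)
    then show "j = \<epsilon> * n" using \<epsilon>2(1) by (metis mult.assoc mult_1)
  qed
  have br: "of_int (n - m) * b (m + n) = of_int (\<epsilon> * (n - m)) * (b m * b n)" for m n
    using automorphism_basis_bracket[OF f, of "Lb m" "Lb n", THEN arg_cong, of "\<lambda>x. Poly_Mapping.lookup (Lc x) (\<epsilon> * (m + n))"]
    by (simp add: lie_automorphismD[OF f] comps_sv_bracket p mult_single lookup_minus algebra_simps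
        flip: single_diff del: lookup_comps single_of_int)
  \<comment> \<open>The sign absorbs the factor \<open>\<epsilon>\<close> in \<open>br\<close>,
    leaving a function multiplicative off the diagonal.\<close>
  define \<beta> where "\<beta> n = of_int \<epsilon> * b n" for n
  have "\<beta> 0 = 1"
    using \<epsilon>(2) \<epsilon>2(2) p[of 0] by (simp add: \<beta>_def) (metis lookup_single_eq single_of_int)
  moreover have "\<beta> (m + n) = \<beta> m * \<beta> n" if "m \<noteq> n" for m n
  proof -
    have "(of_int (n - m) :: complex) \<noteq> 0" using that unfolding of_int_eq_0_iff by simp
    moreover have "of_int (n - m) * b (m + n) = of_int (n - m) * (of_int \<epsilon> * (b m * b n))"
      using br[of n m] by simp
    ultimately have "b (m + n) = of_int \<epsilon> * (b m * b n)"
      by (metis mult_left_cancel)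
    then show ?thesis by (simp add: \<beta>_def algebra_simps)
  qed
  ultimately obtain a where a: "a \<noteq> 0" "\<And>n. \<beta> n = a powi n"
    using power_int_characterI by blast
  have "b n = of_int \<epsilon> * a powi n" for n
    using a(2)[of n] \<epsilon>2(2) by (metis \<beta>_def mult.assoc mult_1)
  then have "Lc (f (sv_basis (Lb n))) = Lc (sigma \<epsilon> 0 a 1 (sv_basis (Lb n)))" for n
    by (simp add: p mult_single mult.commute)
  with \<epsilon>(1) a(1) show ?thesis using that by blast
qed

text \<open>The elements without \<open>L\<close> part are spanned by the \<open>N\<close>,
  \<open>M\<close> and \<open>Y\<close> vectors, and \<open>sigma\<close> maps this span into
  itself.\<close>

lemma Lc_sigma_cong:
  assumes "Lc x = Lc y"
  shows "Lc (sigma \<epsilon> r a d x) = Lc (sigma \<epsilon> r a d y)"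
proof -
  define z where "z = x - y"
  have z: "Poly_Mapping.lookup z (Lb n) = 0" for n
    using assms by (simp flip: lookup_comps add: z_def)
  have "Lc (sigma \<epsilon> r a d z) = 0"
  proof (induction z rule: sv_keys_induct)
    case (basis i c)
    then show ?case by (cases i) (auto simp: sigma_scale in_keys_iff z)
  qed (simp_all add: sigma_add)
  then show ?thesis by (simp add: z_def sigma_diff)
qed

section \<open>Automorphisms that are trivial on the Witt quotient\<close>

lemma of_int_times_single:
  "of_int k * Poly_Mapping.single n c = (Poly_Mapping.single n (of_int k * c) :: laurent)"
  using mult_single[of 0 "of_int k" n c] by simp

lemma single_times_single_minus [simp]:
  "Poly_Mapping.single n 1 * Poly_Mapping.single (- n) 1 = (1 :: laurent)"
  by (simp add: mult_single)

lemma automorphism_witt_trivial: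
  assumes f: "f \<in> lie_automorphisms"
    and L: "\<And>n. Lc (f (sv_basis (Lb n))) = Poly_Mapping.single n 1"
  obtains r d where "d \<noteq> 0"
    "\<And>n. Lc (f (sv_basis (Nb n))) = 0" "\<And>n. Nc (f (sv_basis (Nb n))) = Poly_Mapping.single n 1"
    "\<And>n. Nc (f (sv_basis (Lb n))) = Poly_Mapping.single n (of_int r)"
    "\<And>n. Yc (f (sv_basis (Yb n))) = Poly_Mapping.single (n - r) d"
proof -
  let ?t = "\<lambda>n. Poly_Mapping.single n 1 :: laurent"
  \<comment> \<open>Four unknown blocks: \<open>R\<close> is to vanish and \<open>Q\<close> to equal
    \<open>?t\<close>, while \<open>h\<close> and \<open>E\<close> carry the parameters
    \<open>d\<close> and \<open>r\<close>.\<close>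
  define E where "E n = Nc (f (sv_basis (Lb n)))" for n
  define R where "R n = Lc (f (sv_basis (Nb n)))" for n
  define Q where "Q n = Nc (f (sv_basis (Nb n)))" for n
  define h where "h n = Yc (f (sv_basis (Yb n)))" for n
  note D = lie_automorphismD[OF f]
  note basis = L automorphism_nilradical_Lc_Nc[OF f] E_def[symmetric] R_def[symmetric]
    Q_def[symmetric] h_def[symmetric]
  have euler_t: "euler (?t n) = of_int n * ?t n" for n
    by (simp add: of_int_times_single)
  have R_eq: "of_int n * R (m + n) = ?t m * (euler (R n) - of_int m * R n)" for m n
    using automorphism_basis_bracket[OF f, of "Lb m" "Nb n", THEN arg_cong, of Lc]
    by (simp add: D comps_sv_bracket basis euler_t algebra_simps del: euler_single)
  have "of_int n * R n = euler (R n)" for n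
    using R_eq[of n 0] by simp
  then have R_eq': "of_int n * R (m + n) = of_int (n - m) * (?t m * R n)" for m n
    using R_eq[of n m] by (simp add: algebra_simps)
  have t_nz: "?t n \<noteq> 0" for n by simp
  \<comment> \<open>Taking \<open>n = 0\<close> and \<open>m = 1\<close> kills \<open>R 0\<close>;
    then \<open>m = - n\<close> kills every other \<open>R n\<close>.\<close>
  have "R 0 = 0" using R_eq'[of 0 1] t_nz by simp
  then have R: "R n = 0" for n
    using R_eq'[of n "- n"] t_nz by (cases "n = 0") auto
  have Q_eq: "of_int n * Q (m + n) = ?t m * euler (Q n)" for m n
    using automorphism_basis_bracket[OF f, of "Lb m" "Nb n", THEN arg_cong, of Nc]
    by (simp add: D comps_sv_bracket basis R)
  have "of_int n * Q n = euler (Q n)" for n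
    using Q_eq[of n 0] by simp
  then have "of_int n * Q (m + n) = of_int n * (?t m * Q n)" for m n
    using Q_eq[of n m] by (metis mult.left_commute)
  then have Q_mult: "Q (m + n) = ?t m * Q n" if "n \<noteq> 0" for m n
    using that by (metis mult_left_cancel of_int_eq_0_iff)
  have "?t n * Q 0 = Q n" for n
    using Q_mult[of n "- n"] by (cases "n = 0") (simp_all flip: mult.assoc)
  then have Q': "Q n = ?t n * Q 0" for n by metis
  have h_eq: "Q m * h n = h (m + n)" for m n
    using automorphism_basis_bracket[OF f, of "Nb m" "Yb n", THEN arg_cong, of Yc]
    by (simp add: D comps_sv_bracket basis R)
  \<comment> \<open>Otherwise the image of the nilradical would have no \<open>Y\<close> part and
    miss \<open>Yb 0\<close>.\<close>
  have "\<exists>n. h n \<noteq> 0"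
  proof (rule ccontr)
    assume "\<nexists>n. h n \<noteq> 0"
    then have h0: "Yc (f (sv_basis (Yb n))) = 0" for n by (simp add: h_def)
    obtain x where x: "f x = sv_basis (Yb 0)"
      using D(4) by (metis bij_pointE)
    then have "x \<in> nilradical"
      using nilradical_basis(2)[of 0] by (simp flip: automorphism_nilradical[OF f, of x])
    have M0: "Yc (f (sv_basis (Mb n))) = 0" for n
      by (rule automorphism_Yc_zero[OF f nilradical_basis(1)]) simp
    have "Yc (f x) = 0"
    proof (induction x rule: sv_keys_induct)
      case (basis i c)
      with \<open>x \<in> nilradical\<close> consider n where "i = Mb n" | n where "i = Yb n"
        by (elim keys_nilradical) auto
      then show ?case by cases (simp_all add: D(2) h0 M0)
    next
      case (add y z)
      then show ?case by (simp add: D(1))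
    qed (simp add: D(5))
    then show False by (simp add: x)
  qed
  then obtain n where "h n \<noteq> 0" ..
  moreover from this have "Q 0 = 1" using h_eq[of 0 n] by simp
  ultimately have Q: "Q n = ?t n" and h: "h n = ?t n * h 0" for n
    using Q'[of n] h_eq[of n 0] by simp_all
  have "h 0 \<noteq> 0" using \<open>h n \<noteq> 0\<close> h[of n] by auto
  \<comment> \<open>The density terms with \<open>half\<close> cancel; the case \<open>m = 0\<close>
    is the logarithmic equation.\<close>
  have E_eq: "?t m * euler (h 0) + E m * h 0 = 0" for m
  proof -
    have "cst ((1 - of_int m) / 2) * h m = ?t m * (euler (h 0) + half * h 0) - half * (of_int m * ?t m) * h 0 + E m * h 0"
      using automorphism_basis_bracket[OF f, of "Lb m" "Yb 0", THEN arg_cong, of Yc]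
      by (simp add: D comps_sv_bracket basis R euler_t del: euler_single)
    moreover have "cst ((1 - of_int m) / 2) = half - half * of_int m"
      using single_diff[of "0 :: int" "1 / 2 :: complex" "of_int m / 2"] of_int_times_single[of m 0 "1 / 2"]
      by (simp add: diff_divide_distrib mult.commute)
    ultimately show ?thesis by (simp add: h[of m] algebra_simps)
  qed
  have euler_h: "euler (h 0) = - E 0 * h 0"
    using E_eq[of 0] by (simp add: add_eq_0_iff)
  then obtain k d where kd: "d \<noteq> 0" "h 0 = Poly_Mapping.single k d" "- E 0 = of_int k"
    using euler_logarithmic[OF \<open>h 0 \<noteq> 0\<close> euler_h] by metis
  have "(x - t * y) * z = t * (- y * z) + x * z" for t x y z :: laurent
    by (simp add: algebra_simps)
  \<comment> \<open>Eliminating \<open>euler (h 0)\<close> by means of the case \<open>m = 0\<close>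
    leaves a product in a ring without zero divisors.\<close>
  then have "(E m - ?t m * E 0) * h 0 = 0" for m
    using E_eq[of m, unfolded euler_h] by (rule trans)
  then have "E m = ?t m * E 0" for m
    using \<open>h 0 \<noteq> 0\<close> by (metis eq_iff_diff_eq_0 mult_eq_0_iff)
  moreover have "E 0 = of_int (- k)" using kd(3) by (metis minus_equation_iff of_int_minus)
  ultimately have "E m = Poly_Mapping.single m (of_int (- k))" for m
    by (metis add_0_right mult_1 mult_single single_of_int)
  moreover have "h n = Poly_Mapping.single (n - (- k)) d" for n
    by (simp add: h[of n] kd(2) mult_single)
  ultimately show ?thesis
    using that[of d "- k"] kd(1) R Q by (simp add: E_def R_def Q_def h_def)
qed

section \<open>Unipotent automorphisms are inner\<close>

lemma unipotent_automorphism_fixing_N0: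
  assumes f: "f \<in> lie_automorphisms" and uni: "unipotent f"
    and N0: "f (sv_basis (Nb 0)) = sv_basis (Nb 0)"
  shows "f = id"
proof (rule additive_sv_eqI)
  note D = lie_automorphismD[OF f]
  have U: "Lc (f x) = Lc x" "Nc (f x) = Nc x" for x
    using uni by (simp_all add: unipotent_def)
  \<comment> \<open>\<open>f\<close> commutes with the action of N_0, whose eigenvalues are 0 on
    \<open>L\<close> and \<open>N\<close>, 1 on \<open>Y\<close> and 2 on \<open>M\<close>.\<close>
  have br: "f (basis_bracket (Nb 0) i) = sv_bracket (sv_basis (Nb 0)) (f (sv_basis i))" for i
    using automorphism_basis_bracket[OF f, of "Nb 0" i] by (simp only: N0)
  have L: "f (sv_basis (Lb n)) = sv_basis (Lb n)" for n
    using br[of "Lb n", THEN arg_cong, of Yc] br[of "Lb n", THEN arg_cong, of Mc]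
    by (intro sv_eqI) (simp_all add: U D comps_sv_bracket)
  have N: "f (sv_basis (Nb n)) = sv_basis (Nb n)" for n
    using br[of "Nb n", THEN arg_cong, of Yc] br[of "Nb n", THEN arg_cong, of Mc]
    by (intro sv_eqI) (simp_all add: U D comps_sv_bracket)
  have Y: "f (sv_basis (Yb n)) = sv_basis (Yb n)" for n
    using br[of "Yb n", THEN arg_cong, of Mc] uni nilradical_basis(2)[of n]
    by (intro sv_eqI) (simp_all add: U D comps_sv_bracket unipotent_def)
  have M: "f (sv_basis (Mb n)) = sv_basis (Mb n)" for n
  proof -
    obtain i j c where "sv_basis (Mb n) = c *\<^sub>s sv_bracket (sv_basis (Yb i)) (sv_basis (Yb j))"
      using Mb_as_bracket by blast
    then show ?thesis by (simp only: D Y)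
  qed
  show "f (sv_basis i) = id (sv_basis i)" for i
    using L N Y M by (cases i) simp_all
qed (simp_all add: lie_automorphismD[OF f])

lemma unipotent_comp: "unipotent f \<Longrightarrow> unipotent g \<Longrightarrow> unipotent (f \<circ> g)"
  by (simp add: unipotent_def nilradical_def)

text \<open>Composing with \<open>nexp z\<close> removes the \<open>Y\<close>-part of \<open>f N\<^sub>0 - N\<^sub>0\<close>, and composing with \<open>nexp w\<close>
  then removes the \<open>M\<close>-part.\<close>

lemma unipotent_automorphism_inner:
  assumes f: "f \<in> lie_automorphisms" and uni: "unipotent f"
  shows "f \<in> Inn_sv"
proof -
  let ?N = "sv_basis (Nb 0)"
  define z where "z = f ?N - ?N"
  have z: "z \<in> nilradical"
    using uni by (simp add: z_def unipotent_def nilradical_def)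
  define g where "g = nexp z \<circ> f"
  have g: "g \<in> lie_automorphisms" "unipotent g"
    unfolding g_def by (intro lie_automorphism_comp nexp_automorphism unipotent_comp unipotent_nexp f uni z)+
  \<comment> \<open>The factor 1/2 compensates the eigenvalue 2 of N_0 on the \<open>M\<close>
    part.\<close>
  define w where "w = (1 / 2) *\<^sub>s (g ?N - ?N)"
  have "f ?N = ?N + z" by (simp add: z_def)
  then have "Yc (g ?N) = 0"
    using z by (simp add: g_def nexp_def comps_sv_bracket nilradical_def)
  then have w: "w \<in> nilradical" "Yc w = 0"
    using g(2) by (simp_all add: w_def unipotent_def nilradical_def)
  have "nexp w \<circ> g = id"
  proof (rule unipotent_automorphism_fixing_N0)
    show "nexp w \<circ> g \<in> lie_automorphisms" "unipotent (nexp w \<circ> g)"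
      by (intro lie_automorphism_comp nexp_automorphism unipotent_comp unipotent_nexp g w)+
    have "g ?N = ?N + 2 *\<^sub>s w" by (simp add: w_def)
    then show "(nexp w \<circ> g) ?N = ?N"
      using w by (intro sv_eqI) (simp_all add: nexp_def comps_sv_bracket nilradical_def)
  qed
  then have "nexp (- z) \<circ> (nexp (- w) \<circ> (nexp w \<circ> (nexp z \<circ> f))) = nexp (- z) \<circ> nexp (- w)"
    by (simp only: g_def comp_id)
  then have "f = nexp (- z) \<circ> nexp (- w)"
    using nexp_neg_compose[OF z] nexp_neg_compose[OF w(1)] by (metis comp_assoc id_comp)
  then show ?thesis
    unfolding Inn_sv_eq using z w(1) nexp_compose
    by (metis imageI nilradical_add nilradical_bracket nilradical_scale nilradical_uminus)
qed

text \<open>\<open>\<sigma>\<close> removes the action on the Witt quotient and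
  \<open>\<tau>\<close> the remaining parameters; what is left is unipotent, hence inner.\<close>

lemma automorphism_decomposition:
  assumes f: "f \<in> lie_automorphisms"
  obtains g h where "g \<in> grp_a <#>\<^bsub>Aut_sv\<^esub> grp_t <#>\<^bsub>Aut_sv\<^esub> grp_b" "h \<in> Inn_sv" "f = g \<circ> h"
proof -
  obtain \<epsilon> a where 1: "\<epsilon> \<in> {1, - 1}" "a \<noteq> 0"
    and L: "\<And>n. Lc (f (sv_basis (Lb n))) = Lc (sigma \<epsilon> 0 a 1 (sv_basis (Lb n)))"
    using automorphism_witt[OF f] by metis
  define \<sigma> \<sigma>' where "\<sigma> = sigma \<epsilon> 0 a 1"
    and "\<sigma>' = sigma \<epsilon> (- \<epsilon> * 0) (a powi - \<epsilon>) (inverse 1 * a powi - ((\<epsilon> - 1) div 2 + 0))"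
  have \<sigma>: "\<sigma> \<circ> \<sigma>' = id" "\<sigma>' \<circ> \<sigma> = id"
    unfolding \<sigma>_def \<sigma>'_def by (rule sigma_right_inverse sigma_inverse; use 1 in simp)+
  have \<sigma>'_aut: "\<sigma>' \<in> lie_automorphisms"
    unfolding \<sigma>'_def by (rule sigma_automorphism) (use 1 in auto)
  define f1 where "f1 = \<sigma>' \<circ> f"
  have f1: "f1 \<in> lie_automorphisms"
    unfolding f1_def by (rule lie_automorphism_comp[OF \<sigma>'_aut f])
  have "Lc (f1 (sv_basis (Lb n))) = Lc (\<sigma>' (\<sigma> (sv_basis (Lb n))))" for n
    unfolding f1_def \<sigma>_def \<sigma>'_def comp_apply by (rule Lc_sigma_cong[OF L])
  moreover have "\<sigma>' (\<sigma> x) = x" for x using \<sigma>(2) by (metis comp_apply id_apply)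
  ultimately have "Lc (f1 (sv_basis (Lb n))) = Poly_Mapping.single n 1" for n
    by simp
  then obtain r d where d: "d \<noteq> 0"
    and N: "\<And>n. Lc (f1 (sv_basis (Nb n))) = 0" "\<And>n. Nc (f1 (sv_basis (Nb n))) = Poly_Mapping.single n 1"
    and L1: "\<And>n. Nc (f1 (sv_basis (Lb n))) = Poly_Mapping.single n (of_int r)"
      "\<And>n. Lc (f1 (sv_basis (Lb n))) = Poly_Mapping.single n 1"
    and Y: "\<And>n. Yc (f1 (sv_basis (Yb n))) = Poly_Mapping.single (n - r) d"
    using automorphism_witt_trivial[OF f1] by metis
  define \<tau> \<tau>' where "\<tau> = sigma 1 r 1 d"
    and "\<tau>' = sigma 1 (- 1 * r) (1 powi - 1) (inverse d * 1 powi - ((1 - 1) div 2 + r))"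
  have \<tau>: "\<tau> \<circ> \<tau>' = id" "\<tau>' \<circ> \<tau> = id"
    unfolding \<tau>_def \<tau>'_def by (rule sigma_right_inverse sigma_inverse; use d in simp)+
  have \<tau>': "\<tau>' \<in> lie_automorphisms"
    unfolding \<tau>'_def by (rule sigma_automorphism) (use d in auto)
  define f2 where "f2 = \<tau>' \<circ> f1"
  have f2: "f2 \<in> lie_automorphisms"
    unfolding f2_def by (rule lie_automorphism_comp[OF \<tau>' f1])
  \<comment> \<open>Comparison of \<open>f2\<close> with the identity becomes comparison of
    \<open>f1\<close> with \<open>\<tau>\<close> on basis vectors, because \<open>\<tau>'\<close>
    respects the nilradical and its \<open>M\<close> part.\<close>
  have f2_diff: "f2 x - x = \<tau>' (f1 x - \<tau> x)" for x
    using \<tau>(2) lie_automorphismD(6)[OF \<tau>'] by (metis comp_apply f2_def id_apply)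
  have basis_diff: "f1 (sv_basis i) - \<tau> (sv_basis i) \<in> nilradical" for i
    using N L1 automorphism_nilradical_Lc_Nc[OF f1]
    by (cases i) (simp_all add: nilradical_def \<tau>_def of_int_times_single)
  have "f2 (sv_basis i) - sv_basis i \<in> nilradical" for i
    unfolding f2_diff automorphism_nilradical[OF \<tau>'] by (rule basis_diff)
  then have f2_basis: "Lc (f2 (sv_basis i)) = Lc (sv_basis i)" "Nc (f2 (sv_basis i)) = Nc (sv_basis i)" for i
    by (simp_all add: nilradical_def)
  have f2_LN: "Lc (f2 x) = Lc x \<and> Nc (f2 x) = Nc x" for x
  proof (induction x rule: sv_induct)
    case (basis i c)
    show ?case by (simp add: lie_automorphismD(2)[OF f2] f2_basis)
  next
    case (add x y)
    then show ?case by (simp add: lie_automorphismD(1)[OF f2])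
  qed (simp add: lie_automorphismD(5)[OF f2])
  have Yb: "Yc (f2 (sv_basis (Yb n))) = Poly_Mapping.single n 1" for n
  proof -
    have "Yc (f1 (sv_basis (Yb n)) - \<tau> (sv_basis (Yb n))) = 0"
      by (simp add: Y \<tau>_def mult_single)
    then have "Yc (f2 (sv_basis (Yb n)) - sv_basis (Yb n)) = 0"
      unfolding f2_diff by (intro automorphism_Yc_zero[OF \<tau>' basis_diff])
    then show ?thesis by simp
  qed
  have Mb: "Yc (f2 (sv_basis (Mb n))) = 0" for n
    by (rule automorphism_Yc_zero[OF f2 nilradical_basis(1)]) simp
  have f2_Y: "Yc (f2 x) = Yc x" if "x \<in> nilradical" for x
  proof (induction x rule: sv_keys_induct)
    case (basis i c)
    with that consider n where "i = Mb n" | n where "i = Yb n"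
      by (elim keys_nilradical) auto
    then show ?case by cases (simp_all add: lie_automorphismD(2)[OF f2] Yb Mb)
  next
    case (add y z)
    then show ?case by (simp add: lie_automorphismD(1)[OF f2])
  qed (simp add: lie_automorphismD(5)[OF f2])
  have "unipotent f2" using f2_LN f2_Y by (simp add: unipotent_def)
  then have "f2 \<in> Inn_sv" by (rule unipotent_automorphism_inner[OF f2])
  moreover have "f = (\<sigma> \<circ> \<tau>) \<circ> f2"
    using \<sigma>(1) \<tau>(1) unfolding f2_def f1_def by (metis comp_assoc id_comp)
  moreover have "\<sigma> \<circ> \<tau> = sigma \<epsilon> r a (1 * d * a powi ((1 - 1) div 2 - 1 * r))"
    unfolding \<sigma>_def \<tau>_def using 1 by (subst sigma_compose) simp_all
  then have "\<sigma> \<circ> \<tau> \<in> grp_a <#>\<^bsub>Aut_sv\<^esub> grp_t <#>\<^bsub>Aut_sv\<^esub> grp_b"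
    unfolding grp_at_mult_grp_b using 1 d by fastforce
  ultimately show ?thesis using that by blast
qed

theorem lemma5p3:
  shows "subgroup grp_a Aut_sv \<and> subgroup grp_t Aut_sv \<and> subgroup grp_b Aut_sv \<and>
    (let AT = grp_a <#>\<^bsub>Aut_sv\<^esub> grp_t;
         ATB = AT <#>\<^bsub>Aut_sv\<^esub> grp_b
     in internal_semidirect (Aut_sv\<lparr>carrier := AT\<rparr>) grp_a grp_t \<and>
        internal_semidirect (Aut_sv\<lparr>carrier := ATB\<rparr>) AT grp_b \<and>
        internal_semidirect Aut_sv ATB Inn_sv) \<and>
    Aut_sv\<lparr>carrier := grp_a\<rparr> \<cong> sign_group \<and>
    Aut_sv\<lparr>carrier := grp_t\<rparr> \<cong> integer_group \<and>
    Aut_sv\<lparr>carrier := grp_b\<rparr> \<cong> complex_units \<times>\<times> complex_units"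
proof -
  let ?AT = "grp_a <#>\<^bsub>Aut_sv\<^esub> grp_t"
  let ?ATB = "?AT <#>\<^bsub>Aut_sv\<^esub> grp_b"
  have AT: "subgroup ?AT Aut_sv"
    by (rule Aut_sv.subgroup_set_mult[OF subgroup_grp_a subgroup_grp_t grp_t_conj])
  have ATB: "subgroup ?ATB Aut_sv"
    by (rule Aut_sv.subgroup_set_mult[OF AT subgroup_grp_b grp_b_conj])
  have "internal_semidirect (Aut_sv\<lparr>carrier := ?AT\<rparr>) grp_a grp_t"
    by (rule Aut_sv.internal_semidirect_set_mult[OF subgroup_grp_a subgroup_grp_t grp_t_conj])
      (simp_all add: grp_inter)
  moreover have "internal_semidirect (Aut_sv\<lparr>carrier := ?ATB\<rparr>) ?AT grp_b"
    by (rule Aut_sv.internal_semidirect_set_mult[OF AT subgroup_grp_b grp_b_conj])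
      (simp_all add: grp_inter)
  moreover have "internal_semidirect Aut_sv ?ATB Inn_sv"
    unfolding internal_semidirect_def
  proof (intro conjI)
    show "?ATB \<inter> Inn_sv = {\<one>\<^bsub>Aut_sv\<^esub>}" by (simp only: grp_inter Aut_sv_simps)
    show "?ATB <#>\<^bsub>Aut_sv\<^esub> Inn_sv = carrier Aut_sv"
    proof
      show "?ATB <#>\<^bsub>Aut_sv\<^esub> Inn_sv \<subseteq> carrier Aut_sv"
        by (intro Aut_sv.set_mult_closed subgroup.subset[OF ATB]
            subgroup.subset[OF normal_imp_subgroup[OF normal_Inn_sv]])
      show "carrier Aut_sv \<subseteq> ?ATB <#>\<^bsub>Aut_sv\<^esub> Inn_sv"
      proof
        fix f assume "f \<in> carrier Aut_sv"
        then obtain g h where "g \<in> ?ATB" "h \<in> Inn_sv" "f = g \<otimes>\<^bsub>Aut_sv\<^esub> h"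
          using automorphism_decomposition[of f] by (metis Aut_sv_simps(1,2))
        then show "f \<in> ?ATB <#>\<^bsub>Aut_sv\<^esub> Inn_sv" unfolding set_mult_def by blast
      qed
    qed
  qed (rule group_Aut_sv ATB normal_Inn_sv)+
  ultimately show ?thesis
    unfolding Let_def
    by (intro conjI subgroup_grp_a subgroup_grp_t subgroup_grp_b grp_a_iso grp_t_iso grp_b_iso)
qed

end
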